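(* Let $c_o>0$, $f_o>0$ and let the power spectral density of the noise sources be Lorentz invariant, i.e. $\hat F(\omega)=f_o|\omega|$. Then the Rindler trajectories are the only straight-line trajectories for which the recorded signal is stationary (i.e. its autocorrelation function $\langle U(\tau+\frac{\tau'}{2})U(\tau-\frac{\tau'}{2})\rangle$ does not depend on $\tau$, or equivalently its Wigner transform $W(\tau,\omega)$ does not depend on $\tau$). That is: for a smooth straight-line trajectory parameterized by proper time $\tau\in\mathbb{R}$, $$\tau\mapsto(t(\tau),\boldsymbol{x}(\tau)),\qquad \boldsymbol{x}(\tau)=\boldsymbol{x}_0+z(\tau)\boldsymbol{e},\qquad \dot t(\tau)=\sqrt{1+\dot z(\tau)^2/c_o^2},$$ with $\boldsymbol{x}_0\in\mathbb{R}^3$ and $\boldsymbol{e}\in\mathbb{R}^3$ a unit vector, the recorded signal is stationary if and only if the trajectory is a Rindler trajectory, i.e. there exist $t_0,z_0,\tau_0\in\mathbb{R}$ and $\xi\in\mathbb{R}\setminus\{0\}$ such that $$t(\tau)=t_0+\frac{\xi}{c_o}\sinh\Big(\frac{c_o(\tau-\tau_0)}{\xi}\Big),\qquad z(\tau)=z_0+\xi\cosh\Big(\frac{c_o(\tau-\tau_0)}{\xi}\Big)\qquad\text{for all }\tau\in\mathbb{R}.$$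
   Context: The ambient field $u(t,\boldsymbol{x})$, $t\in\mathbb{R}$, $\boldsymbol{x}\in\mathbb{R}^3$, is a zero-mean Gaussian random field (a scalar wave field in a homogeneous medium with wave speed $c_o$ generated by distant noise sources that are stationary in time and delta-correlated in space, with power spectral density $\hat F$) with covariance $$\langle u(t,\boldsymbol{x})u(t',\boldsymbol{x}')\rangle=\frac{1}{8\pi^2}\int_{\mathbb{R}}\hat F(\omega)\,\mathrm{sinc}\Big(\frac{\omega}{c_o}|\boldsymbol{x}-\boldsymbol{x}'|\Big)e^{i\omega(t-t')}\,d\omega,\qquad \mathrm{sinc}(s)=\frac{\sin s}{s},\ \mathrm{sinc}(0)=1 .$$ The signal recorded by an observer with trajectory $(t(\tau),\boldsymbol{x}(\tau))$ parameterized by proper time $\tau$ (that is, $\dot t^2-|\dot{\boldsymbol{x}}|^2/c_o^2=1$, $\dot t>0$) is $U(\tau)=u(t(\tau),\boldsymbol{x}(\tau))$. Its autocorrelation function is $$\Big\langle U(\tau+\tfrac{\tau'}{2})U(\tau-\tfrac{\tau'}{2})\Big\rangle=\frac{1}{8\pi^2}\int_{\mathbb{R}}\hat F(\omega)\,\mathrm{sinc}\Big(\frac{\omega}{c_o}\big|\boldsymbol{x}(\tau+\tfrac{\tau'}{2})-\boldsymbol{x}(\tau-\tfrac{\tau'}{2})\big|\Big)e^{i\omega(t(\tau+\tau'/2)-t(\tau-\tau'/2))}\,d\omega ,$$ and its Wigner transform is $W(\tau,\omega)=\int_{\mathbb{R}}\langle U(\tau+\frac{\tau'}{2})U(\tau-\frac{\tau'}{2})\rangle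 e^{i\omega\tau'}\,d\tau'$. For $\hat F(\omega)=f_o|\omega|$ and $\tau'\neq0$ the autocorrelation integral is understood as the limit $\epsilon\to0^+$ of the same integral with $\hat F(\omega)$ replaced by $f_o|\omega|e^{-\epsilon|\omega|}$.
   Formalization: The signal is stationary if and only if the trajectory is Rindler or inertial (z affine in τ): an observer at rest also records a stationary signal but is not Rindler for any finite nonzero ξ; W is the limit ε→0+ of the Wigner transform of the damped autocorrelation. *)

theory Defs
  imports "HOL-Probability.Probability"
begin

text \<open>
  Covariance of the ambient field at two space-time points, for wave speed \<open>c\<close> and
  power spectral density \<open>F\<close>.  The function \<open>sinc\<close> is the unnormalised one with
  \<open>sinc 0 = 1\<close>, and \<open>cis a\<close> is \<open>exp (\<i> * a)\<close>.
\<close>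

definition field_covariance ::
    "real \<Rightarrow> (real \<Rightarrow> real) \<Rightarrow> real \<Rightarrow> real^3 \<Rightarrow> real \<Rightarrow> real^3 \<Rightarrow> complex" where
  "field_covariance c F t x t' x' =
     1 / (8 * pi\<^sup>2) *
     (LINT \<omega>|lborel. of_real (F \<omega>) * of_real (sinc (\<omega> / c * norm (x - x'))) * cis (\<omega> * (t - t')))"

text \<open>
  The covariance of \<open>U (\<tau> + s/2)\<close> and \<open>U (\<tau> - s/2)\<close>, where \<open>U \<tau> = u (t \<tau>, x \<tau>)\<close> is the
  recorded signal.
\<close>

definition signal_covariance ::
    "real \<Rightarrow> (real \<Rightarrow> real) \<Rightarrow> (real \<Rightarrow> real) \<Rightarrow> (real \<Rightarrow> real^3) \<Rightarrow> real \<Rightarrow> real \<Rightarrow> complex" where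
  "signal_covariance c F t x \<tau> s =
     field_covariance c F (t (\<tau> + s/2)) (x (\<tau> + s/2)) (t (\<tau> - s/2)) (x (\<tau> - s/2))"

definition lorentz_psd :: "real \<Rightarrow> real \<Rightarrow> real" where
  "lorentz_psd f \<omega> = f * \<bar>\<omega>\<bar>"

definition damped :: "(real \<Rightarrow> real) \<Rightarrow> real \<Rightarrow> real \<Rightarrow> real" where
  "damped F \<epsilon> \<omega> = F \<omega> * exp (- \<epsilon> * \<bar>\<omega>\<bar>)"

text \<open>
  For \<open>F = lorentz_psd f\<close> the covariance integral diverges and is understood as an Abel limit.
  Along a proper-time trajectory the limit exists for every lag \<open>s \<noteq> 0\<close>; it behaves like
  \<open>- f / (4 * pi\<^sup>2 * s\<^sup>2)\<close> near \<open>s = 0\<close>, so the lag \<open>0\<close> is excluded in the definition of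
  stationarity below.
\<close>

definition autocorrelation ::
    "real \<Rightarrow> (real \<Rightarrow> real) \<Rightarrow> (real \<Rightarrow> real) \<Rightarrow> (real \<Rightarrow> real^3) \<Rightarrow> real \<Rightarrow> real \<Rightarrow> complex" where
  "autocorrelation c F t x \<tau> s =
     Lim (at_right 0) (\<lambda>\<epsilon>. signal_covariance c (damped F \<epsilon>) t x \<tau> s)"

text \<open>
  Because of the \<open>1 / s\<^sup>2\<close> singularity the autocorrelation is not Lebesgue integrable in the lag.
  Its Fourier transform is that of the distribution obtained as \<open>\<epsilon>\<close> tends to \<open>0\<close>, so the
  limit has to be taken after the integration; inside the integral it would yield the junk
  value \<open>0\<close> of a non-integrable function.
\<close>

definition wigner ::
    "real \<Rightarrow> (real \<Rightarrow> real) \<Rightarrow> (real \<Rightarrow> real) \<Rightarrow> (real \<Rightarrow> real^3) \<Rightarrow> real \<Rightarrow> real \<Rightarrow> complex" where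
  "wigner c F t x \<tau> \<omega> =
     Lim (at_right 0)
       (\<lambda>\<epsilon>. LINT s|lborel. signal_covariance c (damped F \<epsilon>) t x \<tau> s * cis (\<omega> * s))"

definition stationary_signal ::
    "real \<Rightarrow> (real \<Rightarrow> real) \<Rightarrow> (real \<Rightarrow> real) \<Rightarrow> (real \<Rightarrow> real^3) \<Rightarrow> bool" where
  "stationary_signal c F t x \<longleftrightarrow>
     (\<forall>s \<tau> \<tau>'. s \<noteq> 0 \<longrightarrow> autocorrelation c F t x \<tau> s = autocorrelation c F t x \<tau>' s)"

definition stationary_wigner ::
    "real \<Rightarrow> (real \<Rightarrow> real) \<Rightarrow> (real \<Rightarrow> real) \<Rightarrow> (real \<Rightarrow> real^3) \<Rightarrow> bool" where
  "stationary_wigner c F t x \<longleftrightarrow>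
     (\<forall>\<omega> \<tau> \<tau>'. wigner c F t x \<tau> \<omega> = wigner c F t x \<tau>' \<omega>)"

definition smooth :: "(real \<Rightarrow> real) \<Rightarrow> bool" where
  "smooth g \<longleftrightarrow> (\<forall>n \<tau>. (deriv ^^ n) g differentiable at \<tau>)"

text \<open>
  Motion along a line with coordinate \<open>z\<close>, parameterised by proper time.  Smoothness of \<open>t\<close>
  follows from that of \<open>z\<close>.
\<close>

definition proper_time_motion :: "real \<Rightarrow> (real \<Rightarrow> real) \<Rightarrow> (real \<Rightarrow> real) \<Rightarrow> bool" where
  "proper_time_motion c t z \<longleftrightarrow>
     smooth z \<and>
     (\<forall>\<tau>. (t has_real_derivative sqrt (1 + (deriv z \<tau>)\<^sup>2 / c\<^sup>2)) (at \<tau>))"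

definition straight_line :: "real^3 \<Rightarrow> real^3 \<Rightarrow> (real \<Rightarrow> real) \<Rightarrow> real \<Rightarrow> real^3" where
  "straight_line x0 e z \<tau> = x0 + z \<tau> *\<^sub>R e"

definition rindler_motion :: "real \<Rightarrow> (real \<Rightarrow> real) \<Rightarrow> (real \<Rightarrow> real) \<Rightarrow> bool" where
  "rindler_motion c t z \<longleftrightarrow>
     (\<exists>t0 z0 \<tau>0 \<xi>. \<xi> \<noteq> 0 \<and>
        (\<forall>\<tau>. t \<tau> = t0 + \<xi> / c * sinh (c * (\<tau> - \<tau>0) / \<xi>) \<and>
             z \<tau> = z0 + \<xi> * cosh (c * (\<tau> - \<tau>0) / \<xi>)))"

text \<open>
  Unaccelerated motion, the limit case of Rindler motion for infinite \<open>\<xi>\<close>; \<open>v\<close> is the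
  velocity with respect to proper time.
\<close>

definition inertial_motion :: "real \<Rightarrow> (real \<Rightarrow> real) \<Rightarrow> (real \<Rightarrow> real) \<Rightarrow> bool" where
  "inertial_motion c t z \<longleftrightarrow>
     (\<exists>t0 z0 v. \<forall>\<tau>. t \<tau> = t0 + sqrt (1 + v\<^sup>2 / c\<^sup>2) * \<tau> \<and> z \<tau> = z0 + v * \<tau>)"

text \<open>
  Inertial motion has to be treated separately: an observer at rest already records a
  stationary signal, for every power spectral density, and is not a Rindler observer.
\<close>

lemma rest_stationary_not_rindler:
  assumes "c > 0"
  shows "stationary_signal c F (\<lambda>\<tau>. \<tau>) (straight_line x0 e (\<lambda>_. 0))"
    and "stationary_wigner c F (\<lambda>\<tau>. \<tau>) (straight_line x0 e (\<lambda>_. 0))"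
    and "proper_time_motion c (\<lambda>\<tau>. \<tau>) (\<lambda>_. 0)"
    and "\<not> rindler_motion c (\<lambda>\<tau>. \<tau>) (\<lambda>_. 0)"
proof -
  have cov: "signal_covariance c G (\<lambda>\<tau>. \<tau>) (straight_line x0 e (\<lambda>_. 0)) \<tau> s =
      signal_covariance c G (\<lambda>\<tau>. \<tau>) (straight_line x0 e (\<lambda>_. 0)) \<tau>' s" for G \<tau> \<tau>' s
    by (simp add: signal_covariance_def field_covariance_def straight_line_def)
  show "stationary_signal c F (\<lambda>\<tau>. \<tau>) (straight_line x0 e (\<lambda>_. 0))"
    unfolding stationary_signal_def autocorrelation_def
  proof (intro allI impI)
    fix s \<tau> \<tau>' :: real
    show "Lim (at_right 0) (\<lambda>\<epsilon>. signal_covariance c (damped F \<epsilon>) (\<lambda>\<tau>. \<tau>)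
            (straight_line x0 e (\<lambda>_. 0)) \<tau> s) =
          Lim (at_right 0) (\<lambda>\<epsilon>. signal_covariance c (damped F \<epsilon>) (\<lambda>\<tau>. \<tau>)
            (straight_line x0 e (\<lambda>_. 0)) \<tau>' s)"
      by (subst cov[where \<tau>' = \<tau>']) (rule refl)
  qed
  show "stationary_wigner c F (\<lambda>\<tau>. \<tau>) (straight_line x0 e (\<lambda>_. 0))"
    unfolding stationary_wigner_def wigner_def
  proof (intro allI)
    fix \<omega> \<tau> \<tau>' :: real
    show "Lim (at_right 0) (\<lambda>\<epsilon>. LINT s|lborel. signal_covariance c (damped F \<epsilon>) (\<lambda>\<tau>. \<tau>)
            (straight_line x0 e (\<lambda>_. 0)) \<tau> s * cis (\<omega> * s)) =
          Lim (at_right 0) (\<lambda>\<epsilon>. LINT s|lborel. signal_covariance c (damped F \<epsilon>) (\<lambda>\<tau>. \<tau>)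
            (straight_line x0 e (\<lambda>_. 0)) \<tau>' s * cis (\<omega> * s))"
      by (subst cov[where \<tau>' = \<tau>']) (rule refl)
  qed
  have "(deriv ^^ n) (\<lambda>_. 0 :: real) = (\<lambda>_. 0)" for n
    by (induction n) auto
  then show "proper_time_motion c (\<lambda>\<tau>. \<tau>) (\<lambda>_. 0)"
    unfolding proper_time_motion_def smooth_def by simp
  show "\<not> rindler_motion c (\<lambda>\<tau>. \<tau>) (\<lambda>_. 0)"
  proof
    assume "rindler_motion c (\<lambda>\<tau>. \<tau>) (\<lambda>_. 0)"
    then obtain z0 \<tau>0 \<xi> :: real where "\<xi> \<noteq> 0"
      and z: "\<And>\<tau>. 0 = z0 + \<xi> * cosh (c * (\<tau> - \<tau>0) / \<xi>)"
      unfolding rindler_motion_def by blast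
    have "z0 + \<xi> = 0" "z0 + \<xi> * cosh 1 = 0"
      using z[of \<tau>0] z[of "\<tau>0 + \<xi> / c"] assms \<open>\<xi> \<noteq> 0\<close> by simp_all
    then have "\<xi> * (cosh 1 - 1) = 0"
      unfolding right_diff_distrib by linarith
    moreover have "cosh (0 :: real) < cosh 1"
      by (rule cosh_real_strict_mono) simp_all
    ultimately show False
      using \<open>\<xi> \<noteq> 0\<close> by simp
  qed
qed

end

theory Submission
  imports Defs
begin

text \<open>
  Let \<open>u = t + z/c\<close> and \<open>v = t - z/c\<close> be the light-cone coordinates of the observer, and let
  \<open>\<theta>\<close> be the rapidity: \<open>t' = cosh \<theta>\<close> and \<open>z' = c sinh \<theta>\<close>, hence \<open>u' = exp \<theta>\<close> and
  \<open>v' = exp (- \<theta>)\<close>.  Let \<open>U\<close> and \<open>V\<close> be the increments of \<open>u\<close> and \<open>v\<close> from \<open>\<tau> - s/2\<close> to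
  \<open>\<tau> + s/2\<close>.  For the spectrum \<open>f \<bar>\<omega>\<bar> exp (- \<epsilon> \<bar>\<omega>\<bar>)\<close> the covariance is an elementary Laplace
  integral, equal to \<open>f / (4\<pi>\<^sup>2)\<close> times the real kernel \<open>K\<^sub>\<epsilon>(U, V) = - Re (1 / ((U + i\<epsilon>) (V + i\<epsilon>)))\<close>
  (lemma \<open>signal_covariance_damped_lorentz\<close>).  As \<open>\<epsilon>\<close> tends to \<open>0\<close> this becomes \<open>- 1 / (U V)\<close>, where
  \<open>U V\<close> is the squared Lorentz interval between the two events.  The signal is therefore
  stationary if and only if this interval depends on the lag \<open>s\<close> only.

  Suppose that it does.  The mixed second derivative of
  \<open>(u a - u b) (v a - v b)\<close> in \<open>a\<close> and \<open>b\<close> is \<open>- 2 cosh (\<theta> a - \<theta> b)\<close>, so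
  \<open>\<bar>\<theta> a - \<theta> b\<bar>\<close> depends on \<open>a - b\<close> only.  Then \<open>\<bar>\<theta>'\<bar>\<close> is constant and \<open>\<theta>\<close> is affine
  (lemma \<open>interval_invariant_imp_affine_rapidity\<close>).  Integrating \<open>t'\<close> and \<open>z'\<close> gives an inertial
  motion if the slope of \<open>\<theta>\<close> is \<open>0\<close> and a Rindler motion otherwise.  Conversely, the
  addition theorems of \<open>sinh\<close> and \<open>cosh\<close> show that intervals along a Rindler motion depend on the lag only; for
  inertial motions this is immediate.

  For the Wigner transform the limit \<open>\<epsilon> \<rightarrow> 0\<close> must be taken after the integration over the lag,
  since \<open>1 / (U V)\<close> is not integrable at \<open>s = 0\<close>.  The remedy is to subtract the kernel of the inertial motion
  tangent to the worldline at \<open>\<tau>\<close>, whose integral over the lag is \<open>0\<close> for every \<open>\<epsilon> > 0\<close>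
  (lemma \<open>integral_damped_kernel_linear\<close>).  Central differences are odd in \<open>s\<close>, so \<open>U\<close> and \<open>V\<close> differ from
  their linear parts by \<open>O(s\<^sup>3)\<close> only; this and the bound \<open>U V \<ge> s\<^sup>2\<close> dominate the
  difference by a multiple of \<open>1 / (1 + s\<^sup>2)\<close>, uniformly in \<open>\<epsilon>\<close>.  Dominated convergence gives
  \<open>W(\<tau>, \<omega>) = f / (4\<pi>\<^sup>2) \<integral> (1 / s\<^sup>2 - cos (\<omega> s) / (U V)) ds\<close> (lemma \<open>wigner_eq\<close>).

  So \<open>W\<close> depends on \<open>\<tau>\<close> only through the interval.  Conversely \<open>W\<close> determines the
  interval: up to a term that does not involve the worldline, \<open>W(\<tau>, \<cdot>)\<close> is the cosine transform of
  \<open>1 / s\<^sup>2 - 1 / (U V)\<close>, an even, integrable and nonnegative function of \<open>s\<close>.  Unless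
  its integral is \<open>0\<close>, it can be normalised to a probability density, and Levy's uniqueness theorem for characteristic
  functions applies (lemma \<open>integral_limit_integrand_unique\<close>).
\<close>

section \<open>Laplace integrals on the half-line\<close>

lemma has_bochner_integral_half_line_FTC:
  fixes f F :: "real \<Rightarrow> 'a :: euclidean_space"
  assumes F: "\<And>x. (F has_vector_derivative f x) (at x)"
    and f: "continuous_on UNIV f"
    and int: "integrable lborel (\<lambda>x. indicator {0..} x *\<^sub>R f x)"
    and lim: "(F \<longlongrightarrow> 0) at_top"
  shows "has_bochner_integral lborel (\<lambda>x. indicator {0..} x *\<^sub>R f x) (- F 0)"
proof -
  have "((\<lambda>y. LINT x|lborel. indicator {..y} x *\<^sub>R (indicator {0..} x *\<^sub>R f x))
          \<longlongrightarrow> (LINT x|lborel. indicator {0..} x *\<^sub>R f x)) at_top"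
    by (rule tendsto_integral_at_top) (use int in auto)
  moreover have "\<forall>\<^sub>F y in at_top.
      (LINT x|lborel. indicator {..y} x *\<^sub>R (indicator {0..} x *\<^sub>R f x)) = F y - F 0"
    using eventually_ge_at_top[of 0]
  proof eventually_elim
    case (elim y)
    have "(LINT x|lborel. indicator {..y} x *\<^sub>R (indicator {0..} x *\<^sub>R f x)) =
          (LINT x|lborel. indicator {0..y} x *\<^sub>R f x)"
      by (intro Bochner_Integration.integral_cong) (auto split: split_indicator)
    also have "\<dots> = F y - F 0"
      by (rule integral_FTC_Icc[OF elim])
         (auto intro: has_vector_derivative_at_within F continuous_on_subset[OF f])
    finally show ?case .
  qed
  ultimately have "((\<lambda>y. F y - F 0) \<longlongrightarrow> (LINT x|lborel. indicator {0..} x *\<^sub>R f x)) at_top"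
    by (rule Lim_transform_eventually)
  moreover have "((\<lambda>y. F y - F 0) \<longlongrightarrow> - F 0) at_top"
    using tendsto_diff[OF lim tendsto_const[of "F 0"]] by simp
  ultimately have "(LINT x|lborel. indicator {0..} x *\<^sub>R f x) = - F 0"
    by (rule tendsto_unique[OF trivial_limit_at_top_linorder])
  then show ?thesis
    using int by (simp add: has_bochner_integral_iff)
qed

lemma integrable_half_line_power_exp:
  fixes \<epsilon> :: real
  assumes "\<epsilon> > 0"
  shows "integrable lborel (\<lambda>x. indicator {0..} x *\<^sub>R (x ^ k * exp (- \<epsilon> * x)))"
proof -
  have "integrable lborel (\<lambda>x. (\<epsilon> * x) ^ k * exp (- (\<epsilon> * x)) * indicator {0..} (\<epsilon> * x))"
    using lborel_integrable_real_affine[of "\<lambda>x. x ^ k * exp (- x) * indicator {0..} x" \<epsilon> 0]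
      has_bochner_integral_I0i_power_exp_m'[of k] assms
    by (simp add: has_bochner_integral_iff)
  then have "integrable lborel (\<lambda>x. (1 / \<epsilon> ^ k) * ((\<epsilon> * x) ^ k * exp (- (\<epsilon> * x)) * indicator {0..} (\<epsilon> * x)))"
    by (rule integrable_mult_right)
  also have "(\<lambda>x. (1 / \<epsilon> ^ k) * ((\<epsilon> * x) ^ k * exp (- (\<epsilon> * x)) * indicator {0..} (\<epsilon> * x))) =
      (\<lambda>x. indicator {0..} x *\<^sub>R (x ^ k * exp (- \<epsilon> * x)))"
    using assms by (auto simp: fun_eq_iff power_mult_distrib zero_le_mult_iff split: split_indicator)
  finally show ?thesis .
qed

lemma tendsto_power_mult_exp_complex:
  assumes "Re l > 0"
  shows "((\<lambda>x::real. of_real x ^ k * exp (- l * of_real x)) \<longlongrightarrow> 0) at_top"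
proof (rule tendsto_norm_zero_cancel)
  have "filterlim (\<lambda>x. Re l * x) at_top at_top"
    using assms by (intro filterlim_tendsto_pos_mult_at_top[OF tendsto_const]) (auto intro: filterlim_ident)
  then have "((\<lambda>x. (Re l * x) ^ k / exp (Re l * x)) \<longlongrightarrow> 0) at_top"
    using filterlim_compose[OF tendsto_power_div_exp_0] by blast
  then have "((\<lambda>x. 1 / Re l ^ k * ((Re l * x) ^ k / exp (Re l * x))) \<longlongrightarrow> 0) at_top"
    by (rule tendsto_mult_right_zero)
  then show "((\<lambda>x. norm (of_real x ^ k * exp (- l * of_real x))) \<longlongrightarrow> 0) at_top"
  proof (rule Lim_transform_eventually)
    show "\<forall>\<^sub>F x in at_top. 1 / Re l ^ k * ((Re l * x) ^ k / exp (Re l * x)) =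
        norm (of_real x ^ k * exp (- l * of_real x))"
      using eventually_ge_at_top[of 0]
    proof eventually_elim
      case (elim x)
      have "norm (exp (- l * of_real x)) = exp (- (Re l * x))" by simp
      also have "\<dots> = 1 / exp (Re l * x)" by (simp add: exp_minus divide_inverse)
      finally show ?case
        using assms elim by (simp add: norm_mult norm_power power_mult_distrib del: norm_exp_eq_Re)
    qed
  qed
qed

lemma laplace_one:
  assumes "Re l > 0"
  shows "has_bochner_integral lborel
           (\<lambda>x::real. indicator {0..} x *\<^sub>R exp (- l * of_real x)) (1 / l)"
proof -
  have "l \<noteq> 0" using assms by auto
  have lim: "((\<lambda>x::real. exp (- l * of_real x) / (- l)) \<longlongrightarrow> 0) at_top"
    using tendsto_divide[OF tendsto_power_mult_exp_complex[OF assms, of 0] tendsto_const[of "- l"]]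
      \<open>l \<noteq> 0\<close> by simp
  have int: "integrable lborel (\<lambda>x::real. indicator {0..} x *\<^sub>R exp (- l * of_real x))"
    using integrable_half_line_power_exp[OF assms, of 0]
    by (rule Bochner_Integration.integrable_bound) (auto split: split_indicator)
  have "((\<lambda>w. exp (- l * w) / (- l)) has_field_derivative exp (- l * w)) (at w)" for w
    using \<open>l \<noteq> 0\<close> by (auto intro!: derivative_eq_intros)
  then have D: "((\<lambda>x::real. exp (- l * of_real x) / (- l)) has_vector_derivative exp (- l * of_real x)) (at x)" for x
    by (rule has_vector_derivative_real_field)
  have "has_bochner_integral lborel (\<lambda>x::real. indicator {0..} x *\<^sub>R exp (- l * of_real x))
      (- (exp (- l * of_real 0) / (- l)))"
    by (rule has_bochner_integral_half_line_FTC[OF D _ int lim]) (intro continuous_intros)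
  then show ?thesis by simp
qed

lemma laplace_id:
  assumes "Re l > 0"
  shows "has_bochner_integral lborel
           (\<lambda>x::real. indicator {0..} x *\<^sub>R (of_real x * exp (- l * of_real x))) (1 / l\<^sup>2)"
proof -
  let ?F = "\<lambda>x::real. - (of_real x * exp (- l * of_real x)) / l - exp (- l * of_real x) / l\<^sup>2"
  have "l \<noteq> 0" using assms by auto
  have "(?F \<longlongrightarrow> - 0 / l - 0 / l\<^sup>2) at_top"
    using tendsto_power_mult_exp_complex[OF assms, of 0] tendsto_power_mult_exp_complex[OF assms, of 1]
    by (intro tendsto_intros) (use \<open>l \<noteq> 0\<close> in simp_all)
  then have lim: "(?F \<longlongrightarrow> 0) at_top" by simp
  have int: "integrable lborel (\<lambda>x::real. indicator {0..} x *\<^sub>R (of_real x * exp (- l * of_real x)))"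
    using integrable_half_line_power_exp[OF assms, of 1]
    by (rule Bochner_Integration.integrable_bound) (auto split: split_indicator simp: norm_mult)
  have "((\<lambda>w. - (w * exp (- l * w)) / l - exp (- l * w) / l\<^sup>2) has_field_derivative w * exp (- l * w)) (at w)" for w
    using \<open>l \<noteq> 0\<close>
    by (auto intro!: derivative_eq_intros simp: field_simps power2_eq_square)
  then have D: "(?F has_vector_derivative of_real x * exp (- l * of_real x)) (at x)" for x
    by (rule has_vector_derivative_real_field)
  have "has_bochner_integral lborel (\<lambda>x::real. indicator {0..} x *\<^sub>R (of_real x * exp (- l * of_real x)))
      (- ?F 0)"
    by (rule has_bochner_integral_half_line_FTC[OF D _ int lim]) (intro continuous_intros)
  then show ?thesis by simp
qed

text \<open>
  Imaginary part of the Laplace transform \<open>1 / l\<close> of the constant \<open>1\<close> at \<open>l = \<epsilon> - \<i> p\<close>.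
\<close>

lemma laplace_sin:
  fixes \<epsilon> p :: real
  assumes "\<epsilon> > 0"
  shows "has_bochner_integral lborel (\<lambda>x. indicator {0..} x *\<^sub>R (exp (- \<epsilon> * x) * sin (p * x)))
           (p / (\<epsilon>\<^sup>2 + p\<^sup>2))"
proof -
  have "has_bochner_integral lborel (\<lambda>x. Im (indicator {0..} x *\<^sub>R exp (- Complex \<epsilon> (- p) * of_real x)))
          (Im (1 / Complex \<epsilon> (- p)))"
    by (rule has_bochner_integral_Im[OF laplace_one]) (use assms in simp)
  then show ?thesis
    by (simp add: Im_exp Re_divide Im_divide)
qed

text \<open>
  Real part of the Laplace transform \<open>1 / l\<^sup>2\<close> of the identity at \<open>l = \<epsilon> - \<i> p\<close>.
\<close>

lemma laplace_mult_cos: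
  fixes \<epsilon> p :: real
  assumes "\<epsilon> > 0"
  shows "has_bochner_integral lborel (\<lambda>x. indicator {0..} x *\<^sub>R (x * exp (- \<epsilon> * x) * cos (p * x)))
           ((\<epsilon>\<^sup>2 - p\<^sup>2) / (\<epsilon>\<^sup>2 + p\<^sup>2)\<^sup>2)"
proof -
  have "has_bochner_integral lborel
      (\<lambda>x. Re (indicator {0..} x *\<^sub>R (of_real x * exp (- Complex \<epsilon> (- p) * of_real x))))
      (Re (1 / (Complex \<epsilon> (- p))\<^sup>2))"
    by (rule has_bochner_integral_Re[OF laplace_id]) (use assms in simp)
  moreover have "Re (1 / (Complex \<epsilon> (- p))\<^sup>2) = (\<epsilon>\<^sup>2 - p\<^sup>2) / (\<epsilon>\<^sup>2 + p\<^sup>2)\<^sup>2"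
  proof -
    have "(Complex \<epsilon> (- p))\<^sup>2 = Complex (\<epsilon>\<^sup>2 - p\<^sup>2) (- 2 * \<epsilon> * p)"
      by (simp add: complex_eq_iff power2_eq_square)
    moreover have "(\<epsilon>\<^sup>2 - p\<^sup>2)\<^sup>2 + (- 2 * \<epsilon> * p)\<^sup>2 = (\<epsilon>\<^sup>2 + p\<^sup>2)\<^sup>2"
      by (simp add: power2_eq_square algebra_simps)
    ultimately show ?thesis
      by (simp add: Re_divide)
  qed
  ultimately show ?thesis
    by (simp add: Re_exp mult.assoc)
qed

section \<open>The covariance for the damped Lorentz-invariant spectrum\<close>

text \<open>
  The sine part of the transform of an even function is odd and integrates to \<open>0\<close>.
\<close>

lemma integral_even_cis:
  fixes A :: "real \<Rightarrow> real"
  assumes A: "integrable lborel A" and even: "\<And>x. A (- x) = A x"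
  shows "(LINT x|lborel. of_real (A x) * cis (x * y)) = of_real (LINT x|lborel. A x * cos (x * y))"
proof -
  have [measurable]: "A \<in> borel_measurable borel"
    using A by auto
  have [measurable]: "(\<lambda>x. cis (x * y)) \<in> borel_measurable borel"
    by (intro borel_measurable_continuous_onI continuous_intros)
  have int: "integrable lborel (\<lambda>x. of_real (A x) * cis (x * y))"
    by (rule Bochner_Integration.integrable_bound[OF A]) (auto simp: norm_mult)
  have "(LINT x|lborel. A x * sin (x * y)) = (LINT x|lborel. A (- x) * sin (- x * y))"
    using lborel_integral_real_affine[of "- 1" "\<lambda>x. A x * sin (x * y)" 0] by simp
  also have "\<dots> = - (LINT x|lborel. A x * sin (x * y))"
    by (simp add: even)
  finally have "(LINT x|lborel. A x * sin (x * y)) = 0"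
    by simp
  then show ?thesis
    using integral_Re[OF int] integral_Im[OF int] by (simp add: complex_eq_iff)
qed

definition central_diff :: "(real \<Rightarrow> real) \<Rightarrow> real \<Rightarrow> real \<Rightarrow> real" where
  "central_diff g \<tau> s = g (\<tau> + s / 2) - g (\<tau> - s / 2)"

text \<open>
  Up to the factor \<open>f / (4\<pi>\<^sup>2)\<close>, the covariance for the damped spectrum between two events whose
  light-cone coordinates differ by \<open>U\<close> and \<open>V\<close>; the complex form
  \<open>- Re (1 / ((U + i\<epsilon>) (V + i\<epsilon>)))\<close> is \<open>damped_kernel_eq_Re\<close> below.
\<close>

definition damped_kernel :: "real \<Rightarrow> real \<Rightarrow> real \<Rightarrow> real" where
  "damped_kernel \<epsilon> U V = (\<epsilon>\<^sup>2 - U * V) / ((\<epsilon>\<^sup>2 + U\<^sup>2) * (\<epsilon>\<^sup>2 + V\<^sup>2))"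

lemma damped_kernel_denom_pos:
  fixes \<epsilon> U V :: real
  assumes "\<epsilon> > 0"
  shows "\<epsilon>\<^sup>2 + U\<^sup>2 > 0" "(\<epsilon>\<^sup>2 + U\<^sup>2) * (\<epsilon>\<^sup>2 + V\<^sup>2) > 0"
  using assms by (simp_all add: add_pos_nonneg)

lemma damped_kernel_partial_fractions:
  assumes "\<epsilon> > 0" "U \<noteq> V"
  shows "damped_kernel \<epsilon> U V = (U / (\<epsilon>\<^sup>2 + U\<^sup>2) - V / (\<epsilon>\<^sup>2 + V\<^sup>2)) / (U - V)"
proof -
  have "U / (\<epsilon>\<^sup>2 + U\<^sup>2) - V / (\<epsilon>\<^sup>2 + V\<^sup>2) =
      (U * (\<epsilon>\<^sup>2 + V\<^sup>2) - V * (\<epsilon>\<^sup>2 + U\<^sup>2)) / ((\<epsilon>\<^sup>2 + U\<^sup>2) * (\<epsilon>\<^sup>2 + V\<^sup>2))"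
    using damped_kernel_denom_pos(1)[OF assms(1)] by (intro diff_frac_eq) (metis less_irrefl)+
  also have "U * (\<epsilon>\<^sup>2 + V\<^sup>2) - V * (\<epsilon>\<^sup>2 + U\<^sup>2) = (\<epsilon>\<^sup>2 - U * V) * (U - V)"
    by (simp add: algebra_simps power2_eq_square)
  finally show ?thesis
    using assms(2) by (simp add: damped_kernel_def)
qed

text \<open>
  Here \<open>T\<close> is the time difference and \<open>r\<close> the distance divided by the wave speed.  For \<open>r \<noteq> 0\<close> the
  factor \<open>\<bar>\<omega>\<bar>\<close> cancels against the denominator of \<open>sinc\<close>; a product formula then leaves
  two sine integrals, which are the partial fractions of the kernel.
\<close>

lemma damped_sinc_integral:
  assumes "\<epsilon> > 0"
  shows "has_bochner_integral lborel (\<lambda>\<omega>. \<bar>\<omega>\<bar> * exp (- \<epsilon> * \<bar>\<omega>\<bar>) * sinc (\<omega> * r) * cos (\<omega> * T))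
           (2 * damped_kernel \<epsilon> (T + r) (T - r))"
proof -
  let ?A = "\<lambda>\<omega>. \<bar>\<omega>\<bar> * exp (- \<epsilon> * \<bar>\<omega>\<bar>) * sinc (\<omega> * r) * cos (\<omega> * T)"
  have "has_bochner_integral lborel (\<lambda>\<omega>. indicator {0..} \<omega> *\<^sub>R ?A \<omega>) (damped_kernel \<epsilon> (T + r) (T - r))"
  proof (cases "r = 0")
    case True
    have "(\<lambda>\<omega>. indicator {0..} \<omega> *\<^sub>R ?A \<omega>) = (\<lambda>\<omega>. indicator {0..} \<omega> *\<^sub>R (\<omega> * exp (- \<epsilon> * \<omega>) * cos (T * \<omega>)))"
      using True by (auto simp: fun_eq_iff mult.commute split: split_indicator)
    moreover have "damped_kernel \<epsilon> (T + r) (T - r) = (\<epsilon>\<^sup>2 - T\<^sup>2) / (\<epsilon>\<^sup>2 + T\<^sup>2)\<^sup>2"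
      using True by (simp add: damped_kernel_def power2_eq_square)
    ultimately show ?thesis
      using laplace_mult_cos[OF assms] by simp
  next
    case False
    have "?A \<omega> = (exp (- \<epsilon> * \<omega>) * sin ((T + r) * \<omega>) - exp (- \<epsilon> * \<omega>) * sin ((T - r) * \<omega>)) / (2 * r)"
      if "\<omega> \<ge> 0" for \<omega>
      using that False
      by (simp add: sin_add sin_diff distrib_right left_diff_distrib) (simp add: field_simps)
    note half = this
    have eq: "(\<lambda>\<omega>. indicator {0..} \<omega> *\<^sub>R ?A \<omega>) =
        (\<lambda>\<omega>. (indicator {0..} \<omega> *\<^sub>R (exp (- \<epsilon> * \<omega>) * sin ((T + r) * \<omega>)) -
              indicator {0..} \<omega> *\<^sub>R (exp (- \<epsilon> * \<omega>) * sin ((T - r) * \<omega>))) / (2 * r))"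
    proof (rule ext)
      fix \<omega> :: real
      show "indicator {0..} \<omega> *\<^sub>R ?A \<omega> =
          (indicator {0..} \<omega> *\<^sub>R (exp (- \<epsilon> * \<omega>) * sin ((T + r) * \<omega>)) -
           indicator {0..} \<omega> *\<^sub>R (exp (- \<epsilon> * \<omega>) * sin ((T - r) * \<omega>))) / (2 * r)"
      proof (cases "\<omega> \<ge> 0")
        case True
        then have "indicat_real {0..} \<omega> = 1" by simp
        then show ?thesis
          by (simp only: half[OF True] scaleR_one)
      qed simp
    qed
    have "damped_kernel \<epsilon> (T + r) (T - r) =
        ((T + r) / (\<epsilon>\<^sup>2 + (T + r)\<^sup>2) - (T - r) / (\<epsilon>\<^sup>2 + (T - r)\<^sup>2)) / (2 * r)"
      using damped_kernel_partial_fractions[OF assms, of "T + r" "T - r"] False by simp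
    then show ?thesis
      unfolding eq
      by (simp only:) (intro has_bochner_integral_divide_zero has_bochner_integral_diff laplace_sin assms)
  qed
  from has_bochner_integral_even_function[OF this] show ?thesis
    by simp
qed

lemma field_covariance_damped_lorentz:
  assumes "\<epsilon> > 0"
  shows "field_covariance c (damped (lorentz_psd f) \<epsilon>) t x t' x' =
           of_real (f / (4 * pi\<^sup>2) *
             damped_kernel \<epsilon> (t - t' + norm (x - x') / c) (t - t' - norm (x - x') / c))"
proof -
  define r where "r = norm (x - x') / c"
  define T where "T = t - t'"
  define A where "A \<omega> = \<bar>\<omega>\<bar> * exp (- \<epsilon> * \<bar>\<omega>\<bar>) * sinc (\<omega> * r)" for \<omega>
  have "(LINT \<omega>|lborel. of_real (damped (lorentz_psd f) \<epsilon> \<omega>) *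
            of_real (sinc (\<omega> / c * norm (x - x'))) * cis (\<omega> * (t - t'))) =
        (LINT \<omega>|lborel. of_real f * (of_real (A \<omega>) * cis (\<omega> * T)))"
  proof -
    have "\<omega> / c * norm (x - x') = \<omega> * r" for \<omega>
      by (simp add: r_def)
    then show ?thesis
      by (simp only: A_def T_def damped_def lorentz_psd_def of_real_mult mult.assoc)
  qed
  also have "\<dots> = of_real f * (LINT \<omega>|lborel. of_real (A \<omega>) * cis (\<omega> * T))"
    by simp
  also have "(LINT \<omega>|lborel. of_real (A \<omega>) * cis (\<omega> * T)) = of_real (LINT \<omega>|lborel. A \<omega> * cos (\<omega> * T))"
  proof (rule integral_even_cis)
    show "integrable lborel A"
      using damped_sinc_integral[OF assms, of r 0] by (simp add: A_def [abs_def] has_bochner_integral_iff)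
  qed (simp add: A_def)
  also have "(LINT \<omega>|lborel. A \<omega> * cos (\<omega> * T)) = 2 * damped_kernel \<epsilon> (T + r) (T - r)"
    using damped_sinc_integral[OF assms, of r T] by (simp add: A_def [abs_def] has_bochner_integral_iff)
  finally show ?thesis
    unfolding field_covariance_def by (simp add: r_def T_def)
qed

lemma damped_kernel_commute: "damped_kernel \<epsilon> U V = damped_kernel \<epsilon> V U"
  by (simp add: damped_kernel_def mult.commute)

text \<open>
  The distance \<open>\<bar>Z\<bar>\<close> of the two positions may be replaced by the signed difference \<open>Z\<close>, because the
  kernel is symmetric in its two arguments.  This makes its arguments smooth functions of the lag.
\<close>

lemma signal_covariance_damped_lorentz:
  assumes "\<epsilon> > 0" "norm e = 1"
  shows "signal_covariance c (damped (lorentz_psd f) \<epsilon>) t (straight_line x0 e z) \<tau> s =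
           of_real (f / (4 * pi\<^sup>2) *
             damped_kernel \<epsilon> (central_diff (\<lambda>\<sigma>. t \<sigma> + z \<sigma> / c) \<tau> s)
                             (central_diff (\<lambda>\<sigma>. t \<sigma> - z \<sigma> / c) \<tau> s))"
proof -
  define T where "T = central_diff t \<tau> s"
  define Z where "Z = central_diff z \<tau> s"
  have "norm (straight_line x0 e z (\<tau> + s/2) - straight_line x0 e z (\<tau> - s/2)) = \<bar>Z\<bar>"
    using assms(2) by (simp add: straight_line_def Z_def central_diff_def flip: scaleR_left_diff_distrib)
  moreover have "damped_kernel \<epsilon> (T + \<bar>Z\<bar> / c) (T - \<bar>Z\<bar> / c) = damped_kernel \<epsilon> (T + Z / c) (T - Z / c)"
    by (cases "Z \<ge> 0") (simp_all add: damped_kernel_commute)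
  moreover have "central_diff (\<lambda>\<sigma>. t \<sigma> + z \<sigma> / c) \<tau> s = T + Z / c"
    "central_diff (\<lambda>\<sigma>. t \<sigma> - z \<sigma> / c) \<tau> s = T - Z / c"
    by (simp_all add: T_def Z_def central_diff_def diff_divide_distrib)
  moreover have "t (\<tau> + s/2) - t (\<tau> - s/2) = T"
    by (simp add: T_def central_diff_def)
  ultimately show ?thesis
    unfolding signal_covariance_def field_covariance_damped_lorentz[OF assms(1)]
    by simp
qed

section \<open>Worldlines in light-cone coordinates\<close>

lemma central_diff_minus: "central_diff g \<tau> (- s) = - central_diff g \<tau> s"
  by (simp add: central_diff_def)

lemma central_diff_0 [simp]: "central_diff g \<tau> 0 = 0"
  by (simp add: central_diff_def)

text \<open>
  A central difference is odd in the step, so its Taylor expansion has no quadratic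
  term.  The error \<open>O(s\<^sup>3)\<close>, instead of \<open>O(s\<^sup>2)\<close>, is what keeps the difference between the
  kernels of a worldline and of its tangent bounded near \<open>s = 0\<close>.
\<close>

lemma central_diff_cubic:
  assumes g: "\<And>x. (g has_real_derivative g1 x) (at x)"
    and g1: "\<And>x. (g1 has_real_derivative g2 x) (at x)"
    and g2: "\<And>x. (g2 has_real_derivative g3 x) (at x)"
    and g3: "continuous_on UNIV g3"
  shows "\<exists>M\<ge>0. \<forall>s. \<bar>s\<bar> \<le> 1 \<longrightarrow> \<bar>central_diff g \<tau> s - g1 \<tau> * s\<bar> \<le> M * \<bar>s\<bar> ^ 3"
proof -
  \<comment> \<open>The iterated derivatives in \<open>s\<close>: the inner factors \<open>1/2\<close> and \<open>- 1/2\<close> give the alternating signs,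
  so that \<open>D 2\<close> vanishes at \<open>0\<close>.\<close>
  define D where "D m = [central_diff g \<tau>, \<lambda>s. (g1 (\<tau> + s/2) + g1 (\<tau> - s/2)) / 2,
      \<lambda>s. (g2 (\<tau> + s/2) - g2 (\<tau> - s/2)) / 4, \<lambda>s. (g3 (\<tau> + s/2) + g3 (\<tau> - s/2)) / 8] ! m" for m
  have D: "\<forall>m s. m < 3 \<and> \<bar>s\<bar> \<le> \<bar>x\<bar> \<longrightarrow> (D m has_real_derivative D (Suc m) s) (at s)" for x
  proof (intro allI impI)
    fix m :: nat and s :: real
    assume "m < 3 \<and> \<bar>s\<bar> \<le> \<bar>x\<bar>"
    then consider "m = 0" | "m = 1" | "m = 2" by linarith
    then show "(D m has_real_derivative D (Suc m) s) (at s)"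
    proof cases
      case 1
      then show ?thesis
        by (auto simp: D_def central_diff_def [abs_def] intro!: derivative_eq_intros DERIV_chain2[OF g])
    next
      case 2
      then show ?thesis
        by (auto simp: D_def intro!: derivative_eq_intros DERIV_chain2[OF g1])
    next
      case 3
      then show ?thesis
        by (auto simp: D_def eval_nat_numeral intro!: derivative_eq_intros DERIV_chain2[OF g2])
    qed
  qed
  have "bounded (D 3 ` {-1..1})"
    by (intro compact_imp_bounded compact_continuous_image)
       (auto simp: D_def eval_nat_numeral intro!: continuous_intros continuous_on_compose2[OF g3])
  then obtain B where "\<forall>y\<in>D 3 ` {-1..1}. norm y \<le> B"
    unfolding bounded_iff by blast
  then have B: "\<bar>D 3 s\<bar> \<le> B" if "\<bar>s\<bar> \<le> 1" for s
    using that by (simp add: abs_le_iff)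
  have "B \<ge> 0"
    using B[of 0] by simp
  have "\<bar>central_diff g \<tau> s - g1 \<tau> * s\<bar> \<le> B / 6 * \<bar>s\<bar> ^ 3" if s: "\<bar>s\<bar> \<le> 1" for s
  proof -
    have "D 0 = central_diff g \<tau>"
      by (simp add: D_def)
    from Maclaurin_bi_le[OF this D]
    obtain y where y: "\<bar>y\<bar> \<le> \<bar>s\<bar>"
      and eq: "central_diff g \<tau> s = (\<Sum>m<3. D m 0 / fact m * s ^ m) + D 3 y / fact 3 * s ^ 3"
      by blast
    have "(\<Sum>m<3. D m 0 / fact m * s ^ m) = g1 \<tau> * s"
      by (simp add: D_def eval_nat_numeral)
    then have "\<bar>central_diff g \<tau> s - g1 \<tau> * s\<bar> = \<bar>D 3 y\<bar> / 6 * \<bar>s\<bar> ^ 3"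
      unfolding eq by (simp add: abs_mult power_abs fact_numeral)
    also have "\<dots> \<le> B / 6 * \<bar>s\<bar> ^ 3"
      using B[of y] y s by (intro mult_right_mono) auto
    finally show ?thesis .
  qed
  then show ?thesis
    using \<open>B \<ge> 0\<close> by (intro exI[of _ "B / 6"]) auto
qed

text \<open>
  A motion along a line in proper time, described by its rapidity \<open>\<theta>\<close>; \<open>\<theta>1\<close> and \<open>\<theta>2\<close> are its first
  two derivatives.
\<close>

locale worldline =
  fixes c :: real and t z \<theta> \<theta>1 \<theta>2 :: "real \<Rightarrow> real"
  assumes c: "c > 0"
    and t: "(t has_real_derivative cosh (\<theta> \<tau>)) (at \<tau>)"
    and z: "(z has_real_derivative c * sinh (\<theta> \<tau>)) (at \<tau>)"
    and \<theta>: "(\<theta> has_real_derivative \<theta>1 \<tau>) (at \<tau>)"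
    and \<theta>1: "(\<theta>1 has_real_derivative \<theta>2 \<tau>) (at \<tau>)"
    and \<theta>2: "continuous_on UNIV \<theta>2"
begin

definition u :: "real \<Rightarrow> real" where "u \<tau> = t \<tau> + z \<tau> / c"
definition v :: "real \<Rightarrow> real" where "v \<tau> = t \<tau> - z \<tau> / c"

lemma u: "(u has_real_derivative exp (\<theta> \<tau>)) (at \<tau>)"
  unfolding u_def [abs_def] using c
  by (auto intro!: derivative_eq_intros t z simp: cosh_plus_sinh)

lemma v: "(v has_real_derivative exp (- \<theta> \<tau>)) (at \<tau>)"
  unfolding v_def [abs_def] using c
  by (auto intro!: derivative_eq_intros t z simp: cosh_minus_sinh)

abbreviation "U \<equiv> central_diff u"
abbreviation "V \<equiv> central_diff v"

lemma u_strict_mono: "x < y \<Longrightarrow> u x < u y"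
  by (rule DERIV_pos_imp_increasing) (use u in \<open>auto intro!: exI[of _ "exp _"]\<close>)

lemma U_pos: "s > 0 \<Longrightarrow> U \<tau> s > 0"
  using u_strict_mono[of "\<tau> - s/2" "\<tau> + s/2"] by (simp add: central_diff_def)

text \<open>
  The reversed triangle inequality: along an inertial motion the elapsed proper time is maximal.
  Let \<open>s > 0\<close>.  Since \<open>u' v' = 1\<close>, the function \<open>l u + v / l\<close> has slope at least \<open>2\<close> for every \<open>l > 0\<close>, so
  \<open>l U + V / l \<ge> 2 s\<close>; the choice \<open>l = s / U\<close> gives the claim.
\<close>

lemma interval_ge: "s\<^sup>2 \<le> U \<tau> s * V \<tau> s"
proof -
  have pos: "s\<^sup>2 \<le> U \<tau> s * V \<tau> s" if "s > 0" for s
  proof -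
    define l where "l = s / U \<tau> s"
    have "l > 0"
      using that U_pos by (simp add: l_def)
    define g where "g \<sigma> = l * u \<sigma> + v \<sigma> / l - 2 * \<sigma>" for \<sigma>
    have "g (\<tau> - s/2) \<le> g (\<tau> + s/2)"
    proof (rule DERIV_nonneg_imp_nondecreasing[where f = g])
      fix \<sigma>
      have "(g has_real_derivative l * exp (\<theta> \<sigma>) + exp (- \<theta> \<sigma>) / l - 2) (at \<sigma>)"
        unfolding g_def [abs_def] using \<open>l > 0\<close> by (auto intro!: derivative_eq_intros u v)
      moreover have "l * exp (\<theta> \<sigma>) + exp (- \<theta> \<sigma>) / l - 2 = (l * exp (\<theta> \<sigma>) - 1)\<^sup>2 / (l * exp (\<theta> \<sigma>))"
        using \<open>l > 0\<close> by (simp add: exp_minus field_simps power2_eq_square)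
      ultimately show "\<exists>y. (g has_real_derivative y) (at \<sigma>) \<and> 0 \<le> y"
        using \<open>l > 0\<close> by (metis divide_nonneg_pos exp_gt_zero mult_pos_pos zero_le_power2)
    qed (use that in simp)
    then have "2 * s \<le> l * U \<tau> s + V \<tau> s / l"
      by (simp add: g_def central_diff_def algebra_simps diff_divide_distrib)
    also have "\<dots> = s + U \<tau> s * V \<tau> s / s"
      using U_pos[OF that, of \<tau>] that by (simp add: l_def)
    finally show ?thesis
      using that by (simp add: field_simps power2_eq_square)
  qed
  consider "s > 0" | "s = 0" | "- s > 0" by linarith
  then show ?thesis
    using pos[of s] pos[of "- s"] by cases (auto simp: central_diff_minus)
qed

lemma interval_pos: "s \<noteq> 0 \<Longrightarrow> U \<tau> s * V \<tau> s > 0"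
  using interval_ge[of s \<tau>] by (smt (verit) zero_less_power2)

lemma U_cubic: "\<exists>M\<ge>0. \<forall>s. \<bar>s\<bar> \<le> 1 \<longrightarrow> \<bar>U \<tau> s - exp (\<theta> \<tau>) * s\<bar> \<le> M * \<bar>s\<bar> ^ 3"
proof (rule central_diff_cubic[OF u])
  show "((\<lambda>x. exp (\<theta> x)) has_real_derivative \<theta>1 x * exp (\<theta> x)) (at x)" for x
    by (auto intro!: derivative_eq_intros \<theta>)
  show "((\<lambda>x. \<theta>1 x * exp (\<theta> x)) has_real_derivative (\<theta>2 x + (\<theta>1 x)\<^sup>2) * exp (\<theta> x)) (at x)" for x
    by (auto intro!: derivative_eq_intros \<theta> \<theta>1 simp: algebra_simps power2_eq_square)
  show "continuous_on UNIV (\<lambda>x. (\<theta>2 x + (\<theta>1 x)\<^sup>2) * exp (\<theta> x))"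
    by (intro continuous_intros \<theta>2) (auto intro: DERIV_isCont \<theta> \<theta>1 continuous_at_imp_continuous_on)
qed

lemma V_cubic: "\<exists>M\<ge>0. \<forall>s. \<bar>s\<bar> \<le> 1 \<longrightarrow> \<bar>V \<tau> s - exp (- \<theta> \<tau>) * s\<bar> \<le> M * \<bar>s\<bar> ^ 3"
proof (rule central_diff_cubic[OF v])
  show "((\<lambda>x. exp (- \<theta> x)) has_real_derivative - \<theta>1 x * exp (- \<theta> x)) (at x)" for x
    by (auto intro!: derivative_eq_intros \<theta>)
  show "((\<lambda>x. - \<theta>1 x * exp (- \<theta> x)) has_real_derivative ((\<theta>1 x)\<^sup>2 - \<theta>2 x) * exp (- \<theta> x)) (at x)" for x
    by (auto intro!: derivative_eq_intros \<theta> \<theta>1 simp: algebra_simps power2_eq_square)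
  show "continuous_on UNIV (\<lambda>x. ((\<theta>1 x)\<^sup>2 - \<theta>2 x) * exp (- \<theta> x))"
    by (intro continuous_intros \<theta>2) (auto intro: DERIV_isCont \<theta> \<theta>1 continuous_at_imp_continuous_on)
qed

end

section \<open>Worldlines whose intervals depend on the lag only\<close>

context worldline begin

text \<open>
  The invariance of the interval means that \<open>P a b = (u a - u b) (v a - v b)\<close> does not
  change when \<open>a\<close> and \<open>b\<close> are shifted together.  The same then holds for its mixed second derivative.
\<close>

lemma interval_invariant_imp_cosh:
  assumes inv: "\<And>s \<tau> \<tau>'. U \<tau> s * V \<tau> s = U \<tau>' s * V \<tau>' s"
  shows "cosh (\<theta> (a + h) - \<theta> (b + h)) = cosh (\<theta> a - \<theta> b)"
proof -
  define P where "P a b = (u a - u b) * (v a - v b)" for a b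
  define P1 where "P1 a b = exp (\<theta> a) * (v a - v b) + exp (- \<theta> a) * (u a - u b)" for a b
  have P: "P (a + h) (b + h) = P a b" for a b h
  proof -
    have "P a b = U ((a + b) / 2) (a - b) * V ((a + b) / 2) (a - b)" for a b
    proof -
      have "(a + b) / 2 + (a - b) / 2 = a" "(a + b) / 2 - (a - b) / 2 = b"
        by (simp_all add: field_simps)
      then show ?thesis
        by (simp only: P_def central_diff_def)
    qed
    then show ?thesis
      using inv[of "(a + h + (b + h)) / 2" "a - b" "(a + b) / 2"] by simp
  qed
  have shift: "((\<lambda>x. g (x + h)) has_real_derivative y) (at x)"
    if "(g has_real_derivative y) (at (x + h))" for g y x
    using that by (rule DERIV_shift[THEN iffD1])
  have DP: "((\<lambda>x. P x b) has_real_derivative P1 a b) (at a)" for a b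
    unfolding P_def P1_def by (auto intro!: derivative_eq_intros u v simp: algebra_simps)
  have P1: "P1 (a + h) (b + h) = P1 a b" for b
    using shift[OF DP, of "b + h" a] DP unfolding P by (rule DERIV_unique)
  have DP1: "((\<lambda>x. P1 a x) has_real_derivative - 2 * cosh (\<theta> a - \<theta> b)) (at b)" for a b
    unfolding P1_def
    by (auto intro!: derivative_eq_intros u v simp: cosh_def exp_diff exp_minus field_simps)
  have "- 2 * cosh (\<theta> (a + h) - \<theta> (b + h)) = - 2 * cosh (\<theta> a - \<theta> b)"
    using shift[OF DP1, of "a + h" b] DP1 unfolding P1 by (rule DERIV_unique)
  then show ?thesis by simp
qed

text \<open>
  As \<open>\<bar>\<theta> a - \<theta> b\<bar>\<close> is invariant under shifts, so is the limit \<open>\<bar>\<theta>'\<bar>\<close> of difference quotients.  The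
  sign of \<open>\<theta>'\<close> cannot jump: differentiating the constant \<open>\<theta>'\<^sup>2\<close> gives \<open>\<theta>' \<theta>'' = 0\<close>, so \<open>\<theta>'' = 0\<close>
  unless \<open>\<theta>'\<close> vanishes identically.
\<close>

lemma interval_invariant_imp_affine_rapidity:
  assumes inv: "\<And>s \<tau> \<tau>'. U \<tau> s * V \<tau> s = U \<tau>' s * V \<tau>' s"
  obtains k m where "\<And>\<tau>. \<theta> \<tau> = k * \<tau> + m"
proof -
  have abs_eq: "\<bar>\<theta> (a + h) - \<theta> (b + h)\<bar> = \<bar>\<theta> a - \<theta> b\<bar>" for a b h
    using interval_invariant_imp_cosh[OF inv, of a h b] by simp
  have "\<bar>\<theta>1 x\<bar> = \<bar>\<theta>1 0\<bar>" for x
  proof (rule tendsto_unique[OF at_neq_bot])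
    show "((\<lambda>h. \<bar>(\<theta> (0 + h) - \<theta> 0) / h\<bar>) \<longlongrightarrow> \<bar>\<theta>1 0\<bar>) (at 0)"
      using \<theta>[of 0] unfolding DERIV_def by (rule tendsto_rabs)
    have "((\<lambda>h. \<bar>(\<theta> (x + h) - \<theta> x) / h\<bar>) \<longlongrightarrow> \<bar>\<theta>1 x\<bar>) (at 0)"
      using \<theta>[of x] unfolding DERIV_def by (rule tendsto_rabs)
    then show "((\<lambda>h. \<bar>(\<theta> (0 + h) - \<theta> 0) / h\<bar>) \<longlongrightarrow> \<bar>\<theta>1 x\<bar>) (at 0)"
      using abs_eq[of _ x 0] by (simp add: add.commute abs_divide)
  qed
  then have sq: "(\<theta>1 x)\<^sup>2 = (\<theta>1 0)\<^sup>2" for x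
    by (metis power2_abs)
  have "\<theta>2 x = 0" if "\<theta>1 0 \<noteq> 0" for x
  proof -
    have "((\<lambda>x. (\<theta>1 x)\<^sup>2) has_real_derivative 2 * \<theta>1 x * \<theta>2 x) (at x)"
      by (auto intro!: derivative_eq_intros \<theta>1)
    moreover have "(\<lambda>x. (\<theta>1 x)\<^sup>2) = (\<lambda>_. (\<theta>1 0)\<^sup>2)"
      using sq by (rule ext)
    ultimately have "((\<lambda>_. (\<theta>1 0)\<^sup>2) has_real_derivative 2 * \<theta>1 x * \<theta>2 x) (at x)"
      by (simp only:)
    then have "2 * \<theta>1 x * \<theta>2 x = 0"
      by (rule DERIV_unique) simp
    then show ?thesis
      using sq[of x] that by auto
  qed
  then have const: "\<theta>1 x = \<theta>1 0" for x
    using sq[of x] DERIV_isconst_all[of \<theta>1 x 0] \<theta>1 by (cases "\<theta>1 0 = 0") auto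
  have "((\<lambda>x. \<theta> x - \<theta>1 0 * x) has_real_derivative 0) (at x)" for x
    by (auto intro!: derivative_eq_intros \<theta> simp: const[of x])
  then have "\<theta> x - \<theta>1 0 * x = \<theta> 0 - \<theta>1 0 * 0" for x
    by (intro DERIV_isconst_all) auto
  then have "\<theta> x = \<theta>1 0 * x + \<theta> 0" for x
    by (metis add.commute diff_add_cancel diff_zero mult_zero_right)
  then show thesis
    by (rule that)
qed

end

lemma eq_of_same_derivative:
  fixes f g :: "real \<Rightarrow> real"
  assumes "\<And>x. (f has_real_derivative D x) (at x)" "\<And>x. (g has_real_derivative D x) (at x)"
  shows "f x = f 0 - g 0 + g x"
proof -
  have "((\<lambda>x. f x - g x) has_real_derivative 0) (at x)" for x
    using DERIV_diff[OF assms] by simp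
  then have "f x - g x = f 0 - g 0"
    by (intro DERIV_isconst_all) auto
  then show ?thesis by simp
qed

context worldline begin

text \<open>
  The slope \<open>k\<close> of the rapidity is the proper acceleration divided by \<open>c\<close>, hence \<open>\<xi> = c / k\<close>.
\<close>

lemma affine_rapidity_imp_rindler_or_inertial:
  assumes "\<And>\<tau>. \<theta> \<tau> = k * \<tau> + m"
  shows "rindler_motion c t z \<or> inertial_motion c t z"
proof (cases "k = 0")
  case True
  define w where "w = c * sinh m"
  have cosh: "cosh m = sqrt (1 + w\<^sup>2 / c\<^sup>2)"
  proof -
    have "1 + w\<^sup>2 / c\<^sup>2 = (cosh m)\<^sup>2"
      using c by (simp add: w_def power_mult_distrib cosh_square_eq)
    then show ?thesis by simp
  qed
  have "t \<tau> = t 0 + sqrt (1 + w\<^sup>2 / c\<^sup>2) * \<tau>" for \<tau>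
    using eq_of_same_derivative[of t "\<lambda>_. cosh m" "\<lambda>\<tau>. cosh m * \<tau>" \<tau>] t assms True
    by (auto intro!: derivative_eq_intros simp flip: cosh)
  moreover have "z \<tau> = z 0 + w * \<tau>" for \<tau>
    using eq_of_same_derivative[of z "\<lambda>_. w" "\<lambda>\<tau>. w * \<tau>" \<tau>] z assms True
    by (auto intro!: derivative_eq_intros simp: w_def)
  ultimately show ?thesis
    unfolding inertial_motion_def by blast
next
  case False
  define \<xi> where "\<xi> = c / k"
  define \<tau>0 where "\<tau>0 = - m / k"
  have "\<xi> \<noteq> 0"
    using c False by (simp add: \<xi>_def)
  have \<theta>_eq: "\<theta> \<tau> = c * (\<tau> - \<tau>0) / \<xi>" for \<tau>
    using c False by (simp add: assms \<xi>_def \<tau>0_def field_simps)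
  let ?t = "\<lambda>\<tau>. \<xi> / c * sinh (c * (\<tau> - \<tau>0) / \<xi>)" and ?z = "\<lambda>\<tau>. \<xi> * cosh (c * (\<tau> - \<tau>0) / \<xi>)"
  have t': "t \<tau> = t 0 - ?t 0 + ?t \<tau>" for \<tau>
    by (rule eq_of_same_derivative[OF t])
       (use c \<open>\<xi> \<noteq> 0\<close> in \<open>auto intro!: derivative_eq_intros simp: \<theta>_eq\<close>)
  have z': "z \<tau> = z 0 - ?z 0 + ?z \<tau>" for \<tau>
    by (rule eq_of_same_derivative[OF z])
       (use c \<open>\<xi> \<noteq> 0\<close> in \<open>auto intro!: derivative_eq_intros simp: \<theta>_eq\<close>)
  show ?thesis
    unfolding rindler_motion_def using \<open>\<xi> \<noteq> 0\<close> t' z' by blast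
qed

end

text \<open>
  For a Rindler motion the increments of \<open>t\<close> and \<open>z / c\<close> are \<open>p cosh A\<close> and \<open>p sinh A\<close>, where \<open>p\<close>
  depends on the lag only and \<open>A\<close> is the rapidity at the midpoint \<open>\<tau>\<close>; the squared interval is \<open>p\<^sup>2\<close>.
\<close>

lemma rindler_or_inertial_imp_interval_invariant:
  assumes "c > 0" and "rindler_motion c t z \<or> inertial_motion c t z"
  shows "central_diff (\<lambda>\<sigma>. t \<sigma> + z \<sigma> / c) \<tau> s * central_diff (\<lambda>\<sigma>. t \<sigma> - z \<sigma> / c) \<tau> s =
         central_diff (\<lambda>\<sigma>. t \<sigma> + z \<sigma> / c) \<tau>' s * central_diff (\<lambda>\<sigma>. t \<sigma> - z \<sigma> / c) \<tau>' s"
  using assms(2)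
proof
  assume "rindler_motion c t z"
  then obtain t0 z0 \<tau>0 \<xi> where "\<xi> \<noteq> 0"
    and t: "\<And>\<tau>. t \<tau> = t0 + \<xi> / c * sinh (c * (\<tau> - \<tau>0) / \<xi>)"
    and z: "\<And>\<tau>. z \<tau> = z0 + \<xi> * cosh (c * (\<tau> - \<tau>0) / \<xi>)"
    unfolding rindler_motion_def by blast
  have "central_diff (\<lambda>\<sigma>. t \<sigma> + z \<sigma> / c) \<tau> s * central_diff (\<lambda>\<sigma>. t \<sigma> - z \<sigma> / c) \<tau> s =
      (2 * \<xi> / c * sinh (c * s / (2 * \<xi>)))\<^sup>2" for \<tau>
  proof -
    define A where "A = c * (\<tau> - \<tau>0) / \<xi>"
    define h where "h = c * s / (2 * \<xi>)"
    have plus: "c * (\<tau> + s / 2 - \<tau>0) / \<xi> = A + h" and minus: "c * (\<tau> - s / 2 - \<tau>0) / \<xi> = A - h"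
      using \<open>\<xi> \<noteq> 0\<close> by (simp_all add: A_def h_def field_simps)
    define p where "p = 2 * \<xi> / c * sinh h"
    have "central_diff t \<tau> s = p * cosh A"
      unfolding central_diff_def t plus minus p_def by (simp add: sinh_add sinh_diff algebra_simps)
    moreover have "central_diff z \<tau> s / c = p * sinh A"
      unfolding central_diff_def z plus minus p_def by (simp add: cosh_add cosh_diff algebra_simps)
    moreover have "central_diff (\<lambda>\<sigma>. t \<sigma> + z \<sigma> / c) \<tau> s = central_diff t \<tau> s + central_diff z \<tau> s / c"
      "central_diff (\<lambda>\<sigma>. t \<sigma> - z \<sigma> / c) \<tau> s = central_diff t \<tau> s - central_diff z \<tau> s / c"
      by (simp_all add: central_diff_def diff_divide_distrib)
    ultimately have "central_diff (\<lambda>\<sigma>. t \<sigma> + z \<sigma> / c) \<tau> s * central_diff (\<lambda>\<sigma>. t \<sigma> - z \<sigma> / c) \<tau> s =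
        (p * cosh A + p * sinh A) * (p * cosh A - p * sinh A)"
      by (simp only:)
    also have "\<dots> = p\<^sup>2 * ((cosh A)\<^sup>2 - (sinh A)\<^sup>2)"
      by (simp add: power2_eq_square algebra_simps)
    finally show ?thesis
      by (simp add: hyperbolic_pythagoras h_def p_def)
  qed
  then show ?thesis by simp
next
  assume "inertial_motion c t z"
  then obtain t0 z0 w where "\<And>\<tau>. t \<tau> = t0 + sqrt (1 + w\<^sup>2 / c\<^sup>2) * \<tau>" "\<And>\<tau>. z \<tau> = z0 + w * \<tau>"
    unfolding inertial_motion_def by blast
  then show ?thesis
    by (simp add: central_diff_def algebra_simps add_divide_distrib diff_divide_distrib)
qed

lemma proper_time_motion_imp_worldline:
  assumes "c > 0" "proper_time_motion c t z"
  obtains \<theta> \<theta>1 \<theta>2 where "worldline c t z \<theta> \<theta>1 \<theta>2"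
proof -
  define w1 where "w1 = deriv z"
  define w2 where "w2 = deriv w1"
  define w3 where "w3 = deriv w2"
  have w: "((deriv ^^ n) z has_real_derivative deriv ((deriv ^^ n) z) \<tau>) (at \<tau>)" for n \<tau>
    using assms(2) unfolding proper_time_motion_def smooth_def
    by (simp add: DERIV_deriv_iff_real_differentiable)
  have z: "(z has_real_derivative w1 \<tau>) (at \<tau>)" and w1: "(w1 has_real_derivative w2 \<tau>) (at \<tau>)"
    and w2: "(w2 has_real_derivative w3 \<tau>) (at \<tau>)" and w3: "isCont w3 \<tau>" for \<tau>
    using w[of 0 \<tau>] w[of 1 \<tau>] w[of 2 \<tau>] DERIV_isCont[OF w[of 3 \<tau>]]
    by (simp_all add: w1_def w2_def w3_def eval_nat_numeral)
  define \<theta> where "\<theta> \<tau> = arsinh (w1 \<tau> / c)" for \<tau>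
  define \<theta>1 where "\<theta>1 \<tau> = w2 \<tau> / c / cosh (\<theta> \<tau>)" for \<tau>
  define \<theta>2 where "\<theta>2 \<tau> = (w3 \<tau> / c * cosh (\<theta> \<tau>) - w2 \<tau> / c * (sinh (\<theta> \<tau>) * \<theta>1 \<tau>)) /
      (cosh (\<theta> \<tau>) * cosh (\<theta> \<tau>))" for \<tau>
  \<comment> \<open>The formula \<open>cosh (arsinh x) = sqrt (1 + x\<^sup>2)\<close> turns the proper-time condition into \<open>t' = cosh \<theta>\<close>.\<close>
  have cosh: "cosh (\<theta> \<tau>) = sqrt (1 + (w1 \<tau>)\<^sup>2 / c\<^sup>2)" for \<tau>
    by (simp add: \<theta>_def cosh_arsinh_real power_divide add.commute)
  have cosh_nz: "cosh (\<theta> \<tau>) \<noteq> 0" for \<tau>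
    using cosh_real_pos[of "\<theta> \<tau>"] by simp
  have \<theta>: "(\<theta> has_real_derivative \<theta>1 \<tau>) (at \<tau>)" for \<tau>
  proof -
    have "((\<lambda>\<tau>. arsinh (w1 \<tau> / c)) has_real_derivative
        1 / sqrt ((w1 \<tau> / c)\<^sup>2 + 1) * (w2 \<tau> / c)) (at \<tau>)"
      by (rule DERIV_chain2[OF arsinh_real_has_field_derivative DERIV_cdivide[OF w1]])
    moreover have "1 / sqrt ((w1 \<tau> / c)\<^sup>2 + 1) * (w2 \<tau> / c) = \<theta>1 \<tau>"
      by (simp add: \<theta>1_def cosh power_divide add.commute)
    moreover have "\<theta> = (\<lambda>\<tau>. arsinh (w1 \<tau> / c))"
      by (simp add: \<theta>_def fun_eq_iff)
    ultimately show ?thesis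
      by (simp only:)
  qed
  have coshD: "((\<lambda>\<tau>. cosh (\<theta> \<tau>)) has_real_derivative sinh (\<theta> \<tau>) * \<theta>1 \<tau>) (at \<tau>)" for \<tau>
    by (rule DERIV_chain2[OF _ \<theta>]) (auto intro!: derivative_eq_intros)
  have \<theta>1: "(\<theta>1 has_real_derivative \<theta>2 \<tau>) (at \<tau>)" for \<tau>
    using DERIV_divide[OF DERIV_cdivide[OF w2[of \<tau>], of c] coshD cosh_nz]
    unfolding \<theta>1_def [abs_def] \<theta>2_def by (simp only:)
  have \<theta>2: "isCont \<theta>2 \<tau>" for \<tau>
    unfolding \<theta>2_def [abs_def] using assms(1) cosh_nz
    by (intro continuous_intros w3 DERIV_isCont[OF w2] DERIV_isCont[OF coshD] DERIV_isCont[OF \<theta>] DERIV_isCont[OF \<theta>1])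
       auto
  have "worldline c t z \<theta> \<theta>1 \<theta>2"
  proof
    show "(t has_real_derivative cosh (\<theta> \<tau>)) (at \<tau>)" for \<tau>
      using assms(2) by (simp add: proper_time_motion_def cosh w1_def)
    show "(z has_real_derivative c * sinh (\<theta> \<tau>)) (at \<tau>)" for \<tau>
      using z[of \<tau>] assms(1) by (simp add: \<theta>_def)
    show "continuous_on UNIV \<theta>2"
      by (intro continuous_at_imp_continuous_on ballI \<theta>2)
  qed (fact assms(1) \<theta> \<theta>1)+
  then show thesis by (rule that)
qed

section \<open>Estimates for the damped kernel\<close>

lemma damped_kernel_eq_Re:
  assumes "\<epsilon> > 0"
  shows "damped_kernel \<epsilon> U V = - Re (1 / (Complex U \<epsilon> * Complex V \<epsilon>))"
proof -
  have "(U * V - \<epsilon> * \<epsilon>)\<^sup>2 + (U * \<epsilon> + \<epsilon> * V)\<^sup>2 = (\<epsilon>\<^sup>2 + U\<^sup>2) * (\<epsilon>\<^sup>2 + V\<^sup>2)"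
    by (simp add: power2_eq_square algebra_simps)
  then show ?thesis
    by (simp add: damped_kernel_def Re_divide complex_mult_cnj power2_eq_square minus_divide_left)
qed

text \<open>
  The denominator exceeds \<open>(\<epsilon>\<^sup>2 + U V)\<^sup>2\<close> by \<open>\<epsilon>\<^sup>2 (U - V)\<^sup>2\<close>, while the numerator is at most
  \<open>\<epsilon>\<^sup>2 + U V\<close> in modulus.
\<close>

lemma damped_kernel_bound:
  assumes "\<epsilon> > 0" "s\<^sup>2 \<le> U * V"
  shows "\<bar>damped_kernel \<epsilon> U V\<bar> \<le> 1 / (\<epsilon>\<^sup>2 + s\<^sup>2)"
proof -
  have pos: "0 < \<epsilon>\<^sup>2 + U * V" "0 < \<epsilon>\<^sup>2 + s\<^sup>2"
    using assms zero_le_power2[of s] zero_less_power[of \<epsilon> 2] by linarith+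
  have "(\<epsilon>\<^sup>2 + U\<^sup>2) * (\<epsilon>\<^sup>2 + V\<^sup>2) - (\<epsilon>\<^sup>2 + U * V)\<^sup>2 = (\<epsilon> * (U - V))\<^sup>2"
    by (simp add: power2_eq_square algebra_simps)
  then have "(\<epsilon>\<^sup>2 + U * V)\<^sup>2 \<le> (\<epsilon>\<^sup>2 + U\<^sup>2) * (\<epsilon>\<^sup>2 + V\<^sup>2)"
    using zero_le_power2[of "\<epsilon> * (U - V)"] by linarith
  moreover have "\<bar>\<epsilon>\<^sup>2 - U * V\<bar> \<le> \<epsilon>\<^sup>2 + U * V"
    using assms(2) zero_le_power2[of s] zero_le_power2[of \<epsilon>] by linarith
  ultimately have "\<bar>damped_kernel \<epsilon> U V\<bar> \<le> (\<epsilon>\<^sup>2 + U * V) / (\<epsilon>\<^sup>2 + U * V)\<^sup>2"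
    unfolding damped_kernel_def abs_divide using pos damped_kernel_denom_pos(2)[OF assms(1), of U V]
    by (intro frac_le) auto
  also have "\<dots> = 1 / (\<epsilon>\<^sup>2 + U * V)"
    using pos by (simp add: power2_eq_square)
  also have "\<dots> \<le> 1 / (\<epsilon>\<^sup>2 + s\<^sup>2)"
    using pos assms(2) by (intro divide_left_mono) auto
  finally show ?thesis .
qed

text \<open>
  The right-hand side does not involve \<open>\<epsilon>\<close>: the complex numbers \<open>U + i\<epsilon>\<close> and \<open>U0 + i\<epsilon>\<close> have moduli at
  least \<open>\<bar>U\<bar>\<close> and \<open>\<bar>U0\<bar>\<close>, and \<open>\<epsilon>\<close> cancels from their difference.
\<close>

lemma damped_kernel_diff_bound:
  assumes "\<epsilon> > 0" and nz: "U \<noteq> 0" "V \<noteq> 0" "U0 \<noteq> 0" "V0 \<noteq> 0"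
  shows "\<bar>damped_kernel \<epsilon> U V - damped_kernel \<epsilon> U0 V0\<bar>
           \<le> \<bar>U - U0\<bar> / (\<bar>U\<bar> * \<bar>V\<bar> * \<bar>U0\<bar>) + \<bar>V - V0\<bar> / (\<bar>U0\<bar> * \<bar>V0\<bar> * \<bar>V\<bar>)"
proof -
  define a b a0 b0 where "a = Complex U \<epsilon>" and "b = Complex V \<epsilon>"
    and "a0 = Complex U0 \<epsilon>" and "b0 = Complex V0 \<epsilon>"
  have ge: "\<bar>U\<bar> \<le> norm a" "\<bar>V\<bar> \<le> norm b" "\<bar>U0\<bar> \<le> norm a0" "\<bar>V0\<bar> \<le> norm b0"
    using abs_Re_le_cmod[of a] abs_Re_le_cmod[of b] abs_Re_le_cmod[of a0] abs_Re_le_cmod[of b0]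
    by (simp_all add: a_def b_def a0_def b0_def)
  have nz': "a \<noteq> 0" "b \<noteq> 0" "a0 \<noteq> 0" "b0 \<noteq> 0"
    using assms(1) by (simp_all add: a_def b_def a0_def b0_def complex_eq_iff)
  have diff: "norm (a0 - a) = \<bar>U - U0\<bar>" "norm (b0 - b) = \<bar>V - V0\<bar>"
    by (simp_all add: a_def b_def a0_def b0_def cmod_def)
  have "\<bar>damped_kernel \<epsilon> U V - damped_kernel \<epsilon> U0 V0\<bar> = \<bar>Re (1 / (a * b) - 1 / (a0 * b0))\<bar>"
    by (simp add: damped_kernel_eq_Re[OF assms(1)] a_def b_def a0_def b0_def abs_minus_commute)
  also have "\<dots> \<le> norm (1 / (a * b) - 1 / (a0 * b0))"
    by (rule abs_Re_le_cmod)
  also have "1 / (a * b) - 1 / (a0 * b0) = (a0 - a) / (a * b * a0) + (b0 - b) / (a0 * b0 * b)"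
    using nz' by (simp add: field_simps)
  also have "norm \<dots> \<le> norm ((a0 - a) / (a * b * a0)) + norm ((b0 - b) / (a0 * b0 * b))"
    by (rule norm_triangle_ineq)
  also have "norm ((a0 - a) / (a * b * a0)) \<le> \<bar>U - U0\<bar> / (\<bar>U\<bar> * \<bar>V\<bar> * \<bar>U0\<bar>)"
    unfolding norm_divide norm_mult diff using nz ge by (intro divide_left_mono mult_mono mult_pos_pos) auto
  also have "norm ((b0 - b) / (a0 * b0 * b)) \<le> \<bar>V - V0\<bar> / (\<bar>U0\<bar> * \<bar>V0\<bar> * \<bar>V\<bar>)"
    unfolding norm_divide norm_mult diff using nz ge by (intro divide_left_mono mult_mono mult_pos_pos) auto
  finally show ?thesis by simp
qed

lemma integrable_1_over_1_plus_square: "integrable lborel (\<lambda>s::real. 1 / (1 + s\<^sup>2))"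
  using integrable_inverse_1_plus_square
  by (simp add: set_integrable_def einterval_def inverse_eq_divide)

lemma damped_kernel_measurable:
  assumes [measurable]: "g \<in> borel_measurable M" "h \<in> borel_measurable M"
  shows "(\<lambda>x. damped_kernel \<epsilon> (g x) (h x)) \<in> borel_measurable M"
  unfolding damped_kernel_def by measurable

lemma integrable_damped_kernel:
  assumes "\<epsilon> > 0" and [measurable]: "g \<in> borel_measurable borel" "h \<in> borel_measurable borel"
    and "\<And>s. s\<^sup>2 \<le> g s * h s"
  shows "integrable lborel (\<lambda>s. damped_kernel \<epsilon> (g s) (h s))"
proof (rule Bochner_Integration.integrable_bound)
  show "integrable lborel (\<lambda>s::real. (1 + 1 / \<epsilon>\<^sup>2) * (1 / (1 + s\<^sup>2)))"
    by (intro integrable_mult_right integrable_1_over_1_plus_square)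
  show "(\<lambda>s. damped_kernel \<epsilon> (g s) (h s)) \<in> borel_measurable lborel"
    by (intro damped_kernel_measurable) simp_all
  show "AE s in lborel. norm (damped_kernel \<epsilon> (g s) (h s)) \<le> norm ((1 + 1 / \<epsilon>\<^sup>2) * (1 / (1 + s\<^sup>2)))"
  proof (rule AE_I2)
    fix s :: real
    have pos: "0 < \<epsilon>\<^sup>2" "0 < \<epsilon>\<^sup>2 + s\<^sup>2" "0 < 1 + s\<^sup>2"
      using assms(1) by (simp_all add: add_pos_nonneg)
    have "1 * (1 + s\<^sup>2) \<le> (1 + 1 / \<epsilon>\<^sup>2) * (\<epsilon>\<^sup>2 + s\<^sup>2)"
      using pos by (simp add: field_simps)
    then have "1 / (\<epsilon>\<^sup>2 + s\<^sup>2) \<le> (1 + 1 / \<epsilon>\<^sup>2) / (1 + s\<^sup>2)"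
      using pos by (simp only: frac_le_eq pos_divide_le_eq pos_le_divide_eq times_divide_eq_left) 
    then show "norm (damped_kernel \<epsilon> (g s) (h s)) \<le> norm ((1 + 1 / \<epsilon>\<^sup>2) * (1 / (1 + s\<^sup>2)))"
      using damped_kernel_bound[OF assms(1,4), of s] pos by simp
  qed
qed

text \<open>
  The kernel of an inertial motion of rapidity \<open>ln a\<close>, as a function of the lag.  In the complex form
  both poles lie in the same half-plane, which is why the integral vanishes.  The proof uses a real
  primitive on the half-line: it is a difference of two arctangents, which cancel at infinity, except for \<open>a = 1\<close>,
  where the two poles coincide and the primitive is rational.
\<close>

lemma integral_damped_kernel_linear:
  assumes "\<epsilon> > 0" "a > 0"
  shows "has_bochner_integral lborel (\<lambda>s. damped_kernel \<epsilon> (a * s) (s / a)) 0"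
proof -
  let ?f = "\<lambda>s. damped_kernel \<epsilon> (a * s) (s / a)"
  have nz: "\<epsilon>\<^sup>2 + x\<^sup>2 \<noteq> 0" for x
    using damped_kernel_denom_pos(1)[OF assms(1)] by (metis less_irrefl)
  have int: "integrable lborel ?f"
    by (rule integrable_damped_kernel[OF assms(1)]) (use assms(2) in \<open>auto simp: power2_eq_square\<close>)
  have int': "integrable lborel (\<lambda>s. indicator {0..} s *\<^sub>R ?f s)"
    by (rule integrable_mult_indicator[OF _ int]) simp
  have cont: "continuous_on UNIV ?f"
    unfolding damped_kernel_def using nz assms(2) by (intro continuous_intros) auto
  obtain F where D: "\<And>s. (F has_real_derivative ?f s) (at s)" and lim: "(F \<longlongrightarrow> 0) at_top" and 0: "F 0 = 0"
  proof (cases "a = 1")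
    case True
    show thesis
    proof (rule that[of "\<lambda>s. s / (\<epsilon>\<^sup>2 + s\<^sup>2)"])
      show "((\<lambda>s. s / (\<epsilon>\<^sup>2 + s\<^sup>2)) has_real_derivative ?f s) (at s)" for s
        using nz[of s] True
        by (auto intro!: derivative_eq_intros simp: damped_kernel_def power2_eq_square)
      show "((\<lambda>s. s / (\<epsilon>\<^sup>2 + s\<^sup>2)) \<longlongrightarrow> 0) at_top"
      proof (rule Lim_null_comparison)
        show "\<forall>\<^sub>F s in at_top. norm (s / (\<epsilon>\<^sup>2 + s\<^sup>2)) \<le> inverse s"
          using eventually_gt_at_top[of 0]
        proof eventually_elim
          case (elim s)
          then have "s / (\<epsilon>\<^sup>2 + s\<^sup>2) \<le> s / s\<^sup>2"
            by (intro divide_left_mono) (auto simp: add_nonneg_pos)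
          moreover have "s / s\<^sup>2 = inverse s"
            using elim by (simp add: power2_eq_square inverse_eq_divide)
          ultimately show ?case
            using elim by simp
        qed
        show "((inverse :: real \<Rightarrow> real) \<longlongrightarrow> 0) at_top"
          by (rule tendsto_inverse_0_at_top[OF filterlim_ident])
      qed
    qed simp
  next
    case False
    define d where "d = a - 1 / a"
    have "a * a \<noteq> 1"
      using False assms(2) by (auto simp: square_eq_1_iff)
    then have "d \<noteq> 0"
      using assms(2) by (simp add: d_def field_simps)
    define F where "F s = (arctan (a / \<epsilon> * s) - arctan (1 / (a * \<epsilon>) * s)) / (\<epsilon> * d)" for s
    have arctan_deriv: "((\<lambda>s. arctan (b / \<epsilon> * s)) has_real_derivative \<epsilon> * (b / (\<epsilon>\<^sup>2 + (b * s)\<^sup>2))) (at s)" for b s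
    proof -
      have "((\<lambda>s. arctan (b / \<epsilon> * s)) has_real_derivative inverse (1 + (b / \<epsilon> * s)\<^sup>2) * (b / \<epsilon>)) (at s)"
        using assms(1) by (intro DERIV_chain2[OF DERIV_arctan]) (auto intro!: derivative_eq_intros)
      moreover have "inverse (1 + (b / \<epsilon> * s)\<^sup>2) * (b / \<epsilon>) = \<epsilon> * (b / (\<epsilon>\<^sup>2 + (b * s)\<^sup>2))"
      proof -
        have "1 + (b / \<epsilon> * s)\<^sup>2 = (\<epsilon>\<^sup>2 + (b * s)\<^sup>2) / \<epsilon>\<^sup>2"
          using assms(1) by (simp add: field_simps)
        then show ?thesis
          using assms(1) by (simp add: power2_eq_square)
      qed
      ultimately show ?thesis by (simp only:)
    qed
    have arctan_lim: "((\<lambda>s. arctan (b * s)) \<longlongrightarrow> pi / 2) at_top" if "b > 0" for b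
      by (rule filterlim_compose[OF tendsto_arctan_at_top])
         (rule filterlim_tendsto_pos_mult_at_top[OF tendsto_const that filterlim_ident])
    show thesis
    proof (rule that[of F])
      fix s
      have "(F has_real_derivative
          (\<epsilon> * (a / (\<epsilon>\<^sup>2 + (a * s)\<^sup>2)) - \<epsilon> * (1 / a / (\<epsilon>\<^sup>2 + (1 / a * s)\<^sup>2))) / (\<epsilon> * d)) (at s)"
        unfolding F_def [abs_def] using arctan_deriv[of a s] arctan_deriv[of "1 / a" s]
        by (intro DERIV_cdivide DERIV_diff) simp_all
      moreover have "(\<epsilon> * (a / (\<epsilon>\<^sup>2 + (a * s)\<^sup>2)) - \<epsilon> * (1 / a / (\<epsilon>\<^sup>2 + (1 / a * s)\<^sup>2))) / (\<epsilon> * d) = ?f s"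
      proof -
        have "(\<epsilon> * (a / (\<epsilon>\<^sup>2 + (a * s)\<^sup>2)) - \<epsilon> * (1 / a / (\<epsilon>\<^sup>2 + (1 / a * s)\<^sup>2))) / (\<epsilon> * d) =
            (a / (\<epsilon>\<^sup>2 + (a * s)\<^sup>2) - 1 / a / (\<epsilon>\<^sup>2 + (1 / a * s)\<^sup>2)) / d"
        proof -
          have "(\<epsilon> * p - \<epsilon> * q) / (\<epsilon> * d) = (p - q) / d" for p q
            using assms(1) by (simp flip: right_diff_distrib)
          then show ?thesis .
        qed
        also have "a / (\<epsilon>\<^sup>2 + (a * s)\<^sup>2) - 1 / a / (\<epsilon>\<^sup>2 + (1 / a * s)\<^sup>2) =
            (a * (\<epsilon>\<^sup>2 + (1 / a * s)\<^sup>2) - 1 / a * (\<epsilon>\<^sup>2 + (a * s)\<^sup>2)) /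
              ((\<epsilon>\<^sup>2 + (a * s)\<^sup>2) * (\<epsilon>\<^sup>2 + (1 / a * s)\<^sup>2))"
          using nz by (intro diff_frac_eq) auto
        also have "a * (\<epsilon>\<^sup>2 + (1 / a * s)\<^sup>2) - 1 / a * (\<epsilon>\<^sup>2 + (a * s)\<^sup>2) = (\<epsilon>\<^sup>2 - (a * s) * (1 / a * s)) * d"
          using assms(2) by (simp add: d_def field_simps power2_eq_square)
        finally show ?thesis
          using \<open>d \<noteq> 0\<close> by (simp add: damped_kernel_def)
      qed
      ultimately show "(F has_real_derivative ?f s) (at s)" by (simp only:)
    next
      have "(F \<longlongrightarrow> (pi / 2 - pi / 2) / (\<epsilon> * d)) at_top"
        unfolding F_def [abs_def] using assms \<open>d \<noteq> 0\<close>
        by (intro tendsto_divide tendsto_diff tendsto_const arctan_lim) auto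
      then show "(F \<longlongrightarrow> 0) at_top" by simp
    qed (simp add: F_def)
  qed
  have "has_bochner_integral lborel (\<lambda>s. indicator {0..} s *\<^sub>R ?f s) (- F 0)"
    by (rule has_bochner_integral_half_line_FTC[OF _ cont int' lim])
       (use D in \<open>simp add: has_real_derivative_iff_has_vector_derivative\<close>)
  from has_bochner_integral_even_function[OF this] show ?thesis
    using 0 by (simp add: damped_kernel_def)
qed

text \<open>
  With cubic errors in \<open>U\<close> and \<open>V\<close> the bound of \<open>damped_kernel_diff_bound\<close> is a quotient of terms of order
  \<open>s\<^sup>3\<close>, bounded uniformly in \<open>s\<close> and \<open>\<epsilon>\<close>.  The denominators are controlled by
  \<open>\<bar>U\<bar> \<bar>V\<bar> \<ge> s\<^sup>2\<close>, which together with an upper bound for \<open>\<bar>U\<bar>\<close> also bounds \<open>\<bar>V\<bar>\<close> from below.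
\<close>

lemma damped_kernel_linearisation_bound:
  fixes a s U V M N :: real
  assumes "\<epsilon> > 0" "a > 0" and s: "s \<noteq> 0" "\<bar>s\<bar> \<le> 1" and UV: "s\<^sup>2 \<le> U * V"
    and M: "\<bar>U - a * s\<bar> \<le> M * \<bar>s\<bar> ^ 3" "M \<ge> 0"
    and N: "\<bar>V - s / a\<bar> \<le> N * \<bar>s\<bar> ^ 3" "N \<ge> 0"
  shows "\<bar>damped_kernel \<epsilon> U V - damped_kernel \<epsilon> (a * s) (s / a)\<bar> \<le> M / a + N * (a + M)"
proof -
  have "U * V > 0"
    using UV s(1) by (smt (verit) zero_less_power2)
  then have nz: "U \<noteq> 0" "V \<noteq> 0" and UV': "s\<^sup>2 \<le> \<bar>U\<bar> * \<bar>V\<bar>"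
    using UV by (auto simp flip: abs_mult)
  have "\<bar>U - a * s\<bar> / (\<bar>U\<bar> * \<bar>V\<bar> * \<bar>a * s\<bar>) \<le> M * \<bar>s\<bar> ^ 3 / (s\<^sup>2 * \<bar>a * s\<bar>)"
    using M UV' s(1) \<open>a > 0\<close> by (intro frac_le mult_right_mono) auto
  also have "\<dots> = M / a"
    using s(1) \<open>a > 0\<close> by (simp add: abs_mult power3_eq_cube power2_eq_square)
  finally have 1: "\<bar>U - a * s\<bar> / (\<bar>U\<bar> * \<bar>V\<bar> * \<bar>a * s\<bar>) \<le> M / a" .
  have "\<bar>U\<bar> \<le> \<bar>a * s\<bar> + M * \<bar>s\<bar> ^ 3"
    using M(1) by linarith
  also have "M * \<bar>s\<bar> ^ 3 \<le> M * \<bar>s\<bar>"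
    using s(2) M(2) power_decreasing[of 1 3 "\<bar>s\<bar>"] by (intro mult_left_mono) auto
  finally have "\<bar>U\<bar> \<le> (a + M) * \<bar>s\<bar>"
    using \<open>a > 0\<close> by (simp add: abs_mult distrib_right)
  then have "\<bar>U\<bar> * \<bar>V\<bar> \<le> (a + M) * \<bar>s\<bar> * \<bar>V\<bar>"
    by (rule mult_right_mono) simp
  with UV' have "\<bar>s\<bar> * \<bar>s\<bar> \<le> \<bar>s\<bar> * ((a + M) * \<bar>V\<bar>)"
    by (simp add: power2_eq_square mult_ac)
  then have "\<bar>s\<bar> \<le> (a + M) * \<bar>V\<bar>"
    by (rule mult_left_le_imp_le) (use s(1) in simp)
  then have V_ge: "\<bar>s\<bar> / (a + M) \<le> \<bar>V\<bar>"
    using s(1) \<open>a > 0\<close> M(2) by (simp add: pos_divide_le_eq mult.commute)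
  have "\<bar>V - s / a\<bar> / (\<bar>a * s\<bar> * \<bar>s / a\<bar> * \<bar>V\<bar>) \<le> N * \<bar>s\<bar> ^ 3 / (s\<^sup>2 * (\<bar>s\<bar> / (a + M)))"
  proof (intro frac_le)
    have "\<bar>a * s\<bar> * \<bar>s / a\<bar> = s\<^sup>2"
      using \<open>a > 0\<close> by (simp add: abs_mult power2_eq_square)
    then show "s\<^sup>2 * (\<bar>s\<bar> / (a + M)) \<le> \<bar>a * s\<bar> * \<bar>s / a\<bar> * \<bar>V\<bar>"
      using V_ge by (simp only:) (rule mult_left_mono, simp_all)
  qed (use N s(1) \<open>a > 0\<close> M(2) in auto)
  also have "\<dots> = N * (a + M)"
    using s(1) \<open>a > 0\<close> M(2) by (simp add: power3_eq_cube power2_eq_square)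
  finally have 2: "\<bar>V - s / a\<bar> / (\<bar>a * s\<bar> * \<bar>s / a\<bar> * \<bar>V\<bar>) \<le> N * (a + M)" .
  have "a * s \<noteq> 0" "s / a \<noteq> 0"
    using s(1) \<open>a > 0\<close> by simp_all
  from damped_kernel_diff_bound[OF \<open>\<epsilon> > 0\<close> nz this] 1 2 show ?thesis
    by linarith
qed

lemma damped_kernel_tendsto:
  assumes "x \<noteq> 0" "y \<noteq> 0"
  shows "((\<lambda>\<epsilon>. damped_kernel \<epsilon> x y) \<longlongrightarrow> - 1 / (x * y)) (at_right 0)"
proof -
  have "((\<lambda>\<epsilon>. damped_kernel \<epsilon> x y) \<longlongrightarrow> (0\<^sup>2 - x * y) / ((0\<^sup>2 + x\<^sup>2) * (0\<^sup>2 + y\<^sup>2))) (at_right 0)"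
    unfolding damped_kernel_def using assms by (intro tendsto_intros) auto
  also have "(0\<^sup>2 - x * y) / ((0\<^sup>2 + x\<^sup>2) * (0\<^sup>2 + y\<^sup>2)) = - 1 / (x * y)"
    using assms by (simp add: power2_eq_square)
  finally show ?thesis .
qed

section \<open>Uniqueness for cosine transforms\<close>

text \<open>
  Nonnegative functions with the same integral \<open>m > 0\<close> become probability densities after division by
  \<open>m\<close>; their characteristic functions are the cosine transforms because the functions are even.
\<close>

lemma cosine_transform_unique:
  fixes g h :: "real \<Rightarrow> real"
  assumes g: "integrable lborel g" "\<And>x. g x \<ge> 0" "\<And>x. g (- x) = g x"
    and h: "integrable lborel h" "\<And>x. h x \<ge> 0" "\<And>x. h (- x) = h x"
    and eq: "\<And>y. (LINT x|lborel. g x * cos (x * y)) = (LINT x|lborel. h x * cos (x * y))"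
  shows "AE x in lborel. g x = h x"
proof -
  define m where "m = (LINT x|lborel. g x)"
  have m: "(LINT x|lborel. g x) = m" "(LINT x|lborel. h x) = m"
    using eq[of 0] by (simp_all add: m_def)
  show ?thesis
  proof (cases "m = 0")
    case True
    have "AE x in lborel. g x = 0" "AE x in lborel. h x = 0"
      using integral_nonneg_eq_0_iff_AE[OF g(1)] integral_nonneg_eq_0_iff_AE[OF h(1)] g(2) h(2) m True by simp_all
    then show ?thesis
      by eventually_elim simp
  next
    case False
    then have "m > 0"
      using g(2) by (simp add: m_def less_le)
    define P where "P k = density lborel (\<lambda>x. ennreal (k x / m))" for k :: "real \<Rightarrow> real"
    have P: "real_distribution (P k) \<and> char (P k) = (\<lambda>y. of_real ((LINT x|lborel. k x * cos (x * y)) / m))"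
      if k: "integrable lborel k" "\<And>x. k x \<ge> 0" "\<And>x. k (- x) = k x" "(LINT x|lborel. k x) = m" for k
    proof
      have meas [measurable]: "k \<in> borel_measurable borel"
        using k(1) by auto
      have "(\<integral>\<^sup>+ x. ennreal (k x / m) \<partial>lborel) = ennreal (LINT x|lborel. k x / m)"
        using k(1,2) \<open>m > 0\<close> by (intro nn_integral_eq_integral) auto
      also have "\<dots> = 1"
        using k(4) \<open>m > 0\<close> by simp
      finally have "emeasure (P k) (space (P k)) = 1"
        by (simp add: P_def emeasure_density cong: nn_integral_cong)
      then have "prob_space (P k)"
        by (rule prob_spaceI)
      then show "real_distribution (P k)"
        by (simp add: real_distribution_def real_distribution_axioms_def P_def)
      show "char (P k) = (\<lambda>y. of_real ((LINT x|lborel. k x * cos (x * y)) / m))"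
      proof
        fix y
        have [measurable]: "(\<lambda>x. cis (x * y)) \<in> borel_measurable borel"
          by (intro borel_measurable_continuous_onI continuous_intros)
        have "char (P k) y = (LINT x|P k. cis (x * y))"
          by (simp add: char_def cis_conv_exp mult.commute)
        also have "\<dots> = (LINT x|lborel. (k x / m) *\<^sub>R cis (x * y))"
          unfolding P_def using k(2) \<open>m > 0\<close>
          by (intro integral_density) auto
        also have "\<dots> = (LINT x|lborel. of_real (k x / m) * cis (x * y))"
          by (simp add: scaleR_conv_of_real)
        also have "\<dots> = of_real (LINT x|lborel. k x / m * cos (x * y))"
          by (rule integral_even_cis) (use k(1,3) in simp_all)
        finally show "char (P k) y = of_real ((LINT x|lborel. k x * cos (x * y)) / m)"
          by simp
      qed
    qed
    have "P g = P h"
      using P[OF g m(1)] P[OF h m(2)] eq by (intro Levy_uniqueness) simp_all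
    moreover have [measurable]: "g \<in> borel_measurable borel" "h \<in> borel_measurable borel"
      using g(1) h(1) by auto
    have "(\<integral>\<^sup>+ x. ennreal (g x / m) \<partial>lborel) \<noteq> \<infinity>"
      using g \<open>m > 0\<close> by (subst nn_integral_eq_integral) auto
    ultimately have "AE x in lborel. ennreal (g x / m) = ennreal (h x / m)"
      unfolding P_def by (subst (asm) finite_density_unique) auto
    then show ?thesis
      by eventually_elim (use \<open>m > 0\<close> g(2) h(2) in \<open>simp add: ennreal_inj\<close>)
  qed
qed

lemma AE_lborel_eq_imp_eq_on_open:
  fixes g h :: "'a :: euclidean_space \<Rightarrow> real"
  assumes "AE x in lborel. g x = h x" "open S" "continuous_on S g" "continuous_on S h" "x \<in> S"
  shows "g x = h x"
proof (rule ccontr)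
  assume "g x \<noteq> h x"
  define N where "N = S \<inter> (\<lambda>x. g x - h x) -` (- {0})"
  have "open N"
    unfolding N_def by (intro continuous_open_preimage continuous_intros assms open_Compl closed_singleton)
  moreover have "x \<in> N"
    using \<open>x \<in> S\<close> \<open>g x \<noteq> h x\<close> by (simp add: N_def)
  moreover have "negligible N"
  proof -
    have "AE x in lborel. x \<notin> N"
      using assms(1) by eventually_elim (simp add: N_def)
    then have "N \<in> null_sets lborel"
      using \<open>open N\<close> by (simp add: AE_iff_null_sets)
    then show ?thesis
      by (simp add: negligible_iff_null_sets null_sets_completionI)
  qed
  ultimately show False
    using open_not_negligible by blast
qed

section \<open>The autocorrelation and its Wigner transform\<close>

lemma abs_one_minus_cos_le: "\<bar>cos x - 1\<bar> \<le> x\<^sup>2 / 2" for x :: real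
proof -
  have "cos x = 1 - 2 * (sin (x / 2))\<^sup>2"
    using cos_double_sin[of "x / 2"] by simp
  moreover have "(sin (x / 2))\<^sup>2 \<le> (x / 2)\<^sup>2"
    using abs_sin_x_le_abs_x[of "x / 2"] by (simp only: abs_le_square_iff)
  ultimately show ?thesis
    by (simp add: power_divide)
qed

context worldline begin

lemma U_V_continuous: "continuous_on A (U \<tau>)" "continuous_on A (V \<tau>)"
proof -
  have "continuous_on UNIV u" "continuous_on UNIV v"
    by (auto intro!: continuous_at_imp_continuous_on DERIV_isCont u v)
  then show "continuous_on A (U \<tau>)" "continuous_on A (V \<tau>)"
    unfolding central_diff_def [abs_def]
    by (auto intro!: continuous_intros elim!: continuous_on_compose2)
qed

lemma U_V_measurable [measurable]: "U \<tau> \<in> borel_measurable borel" "V \<tau> \<in> borel_measurable borel"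
  by (intro borel_measurable_continuous_onI U_V_continuous)+

text \<open>
  The second term is the kernel of the inertial motion tangent to the worldline at \<open>\<tau>\<close>.  Its
  integral is \<open>0\<close>, so it changes the integrand but not the integral.
\<close>

definition damped_integrand :: "real \<Rightarrow> real \<Rightarrow> real \<Rightarrow> real \<Rightarrow> real" where
  "damped_integrand \<tau> \<omega> \<epsilon> s =
     damped_kernel \<epsilon> (U \<tau> s) (V \<tau> s) * cos (s * \<omega>)
     - damped_kernel \<epsilon> (exp (\<theta> \<tau>) * s) (s / exp (\<theta> \<tau>))"

text \<open>
  At \<open>s = 0\<close> both quotients have the default value \<open>0\<close>, which agrees with the limit of
  \<open>damped_integrand\<close> there.
\<close>

definition limit_integrand :: "real \<Rightarrow> real \<Rightarrow> real \<Rightarrow> real" where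
  "limit_integrand \<tau> \<omega> s = 1 / s\<^sup>2 - cos (s * \<omega>) / (U \<tau> s * V \<tau> s)"

text \<open>
  For \<open>\<bar>s\<bar> \<le> 1\<close> the bound combines \<open>damped_kernel_linearisation_bound\<close> with the quadratic zero of
  \<open>1 - cos (s \<omega>)\<close>, which compensates the factor \<open>1 / s\<^sup>2\<close>; for larger \<open>s\<close> each of the two kernels decays
  like \<open>1 / s\<^sup>2\<close> by itself.
\<close>

lemma damped_integrand_bound:
  "\<exists>B. \<forall>\<epsilon>>0. \<forall>s. \<bar>damped_integrand \<tau> \<omega> \<epsilon> s\<bar> \<le> B * (1 / (1 + s\<^sup>2))"
proof -
  define a where "a = exp (\<theta> \<tau>)"
  have "a > 0" by (simp add: a_def)
  obtain M where "M \<ge> 0" and M: "\<And>s. \<bar>s\<bar> \<le> 1 \<Longrightarrow> \<bar>U \<tau> s - a * s\<bar> \<le> M * \<bar>s\<bar> ^ 3"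
    using U_cubic[of \<tau>] by (auto simp: a_def)
  obtain N where "N \<ge> 0" and N: "\<And>s. \<bar>s\<bar> \<le> 1 \<Longrightarrow> \<bar>V \<tau> s - s / a\<bar> \<le> N * \<bar>s\<bar> ^ 3"
    using V_cubic[of \<tau>] by (auto simp: a_def exp_minus divide_inverse mult.commute)
  \<comment> \<open>The first two summands bound the difference of the kernels for \<open>\<bar>s\<bar> \<le> 1\<close>, the last one bounds the
  effect of the cosine.\<close>
  define C where "C = M / a + N * (a + M) + \<omega>\<^sup>2"
  have "C \<ge> 0"
    using \<open>a > 0\<close> \<open>M \<ge> 0\<close> \<open>N \<ge> 0\<close> by (simp add: C_def)
  have "\<bar>damped_integrand \<tau> \<omega> \<epsilon> s\<bar> \<le> (2 * C + 4) * (1 / (1 + s\<^sup>2))" if "\<epsilon> > 0" for \<epsilon> s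
  proof -
    define K where "K = damped_kernel \<epsilon> (U \<tau> s) (V \<tau> s)"
    define K0 where "K0 = damped_kernel \<epsilon> (a * s) (s / a)"
    have int: "damped_integrand \<tau> \<omega> \<epsilon> s = K * cos (s * \<omega>) - K0"
      by (simp add: damped_integrand_def K_def K0_def a_def)
    have K_le: "\<bar>K\<bar> \<le> 1 / (\<epsilon>\<^sup>2 + s\<^sup>2)" and K0_le: "\<bar>K0\<bar> \<le> 1 / (\<epsilon>\<^sup>2 + s\<^sup>2)"
      using damped_kernel_bound[OF that interval_ge] damped_kernel_bound[OF that, of s "a * s" "s / a"] \<open>a > 0\<close>
      by (simp_all add: K_def K0_def power2_eq_square)
    consider "s = 0" | "s \<noteq> 0" "\<bar>s\<bar> \<le> 1" | "\<bar>s\<bar> > 1" by linarith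
    then show ?thesis
    proof cases
      case 1
      then show ?thesis
        using \<open>C \<ge> 0\<close> by (simp add: damped_integrand_def)
    next
      case 2
      have diff: "\<bar>K - K0\<bar> \<le> M / a + N * (a + M)"
        unfolding K_def K0_def
        by (intro damped_kernel_linearisation_bound that interval_ge M N) fact+
      have "\<bar>K0\<bar> \<le> 1 / s\<^sup>2"
        using K0_le 2(1) that by (rule_tac order_trans[OF K0_le]) (simp add: frac_le)
      then have "\<bar>K0\<bar> * \<bar>cos (s * \<omega>) - 1\<bar> \<le> 1 / s\<^sup>2 * ((s * \<omega>)\<^sup>2 / 2)"
        using abs_one_minus_cos_le by (intro mult_mono) auto
      also have "\<dots> \<le> \<omega>\<^sup>2"
        using 2(1) by (simp add: power_mult_distrib)
      finally have "\<bar>K0 * (cos (s * \<omega>) - 1)\<bar> \<le> \<omega>\<^sup>2"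
        by (simp add: abs_mult)
      moreover have "\<bar>(K - K0) * cos (s * \<omega>)\<bar> \<le> \<bar>K - K0\<bar>"
        by (simp add: abs_mult mult_left_le)
      moreover have "damped_integrand \<tau> \<omega> \<epsilon> s = (K - K0) * cos (s * \<omega>) + K0 * (cos (s * \<omega>) - 1)"
        by (simp add: int algebra_simps)
      ultimately have "\<bar>damped_integrand \<tau> \<omega> \<epsilon> s\<bar> \<le> C"
        using diff unfolding C_def by linarith
      also have "C * (1 + s\<^sup>2) \<le> C * 2"
        using 2(2) \<open>C \<ge> 0\<close> by (intro mult_left_mono) (auto simp: abs_square_le_1)
      then have "C \<le> (2 * C + 4) * (1 / (1 + s\<^sup>2))"
        by (simp add: pos_le_divide_eq add_pos_nonneg)
      finally show ?thesis .
    next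
      case 3
      then have "s\<^sup>2 > 1"
        by (metis abs_ge_zero one_less_power power2_abs zero_less_numeral)
      have inv: "1 / (\<epsilon>\<^sup>2 + s\<^sup>2) \<le> 2 * (1 / (1 + s\<^sup>2))"
      proof -
        have "(1 + p) / 2 \<le> q + p \<and> 0 < (1 + p) / 2" if "p > 1" "q \<ge> 0" for p q :: real
          using that by simp
        from this[OF \<open>s\<^sup>2 > 1\<close> zero_le_power2[of \<epsilon>]]
        have "1 / (\<epsilon>\<^sup>2 + s\<^sup>2) \<le> 1 / ((1 + s\<^sup>2) / 2)"
          by (intro frac_le) auto
        then show ?thesis by simp
      qed
      have "\<bar>K * cos (s * \<omega>)\<bar> \<le> \<bar>K\<bar>"
        by (simp add: abs_mult mult_left_le)
      then have "\<bar>damped_integrand \<tau> \<omega> \<epsilon> s\<bar> \<le> 4 * (1 / (1 + s\<^sup>2))"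
        using K_le K0_le inv unfolding int by linarith
      also have "\<dots> \<le> (2 * C + 4) * (1 / (1 + s\<^sup>2))"
        using \<open>C \<ge> 0\<close> by (intro mult_right_mono) auto
      finally show ?thesis .
    qed
  qed
  then show ?thesis by blast
qed

lemma U_V_nonzero: "s \<noteq> 0 \<Longrightarrow> U \<tau> s \<noteq> 0" "s \<noteq> 0 \<Longrightarrow> V \<tau> s \<noteq> 0"
  using interval_pos[of s \<tau>] by auto

lemma damped_integrand_tendsto:
  "((\<lambda>\<epsilon>. damped_integrand \<tau> \<omega> \<epsilon> s) \<longlongrightarrow> limit_integrand \<tau> \<omega> s) (at_right 0)"
proof (cases "s = 0")
  case True
  then show ?thesis
    by (simp add: damped_integrand_def limit_integrand_def)
next
  case False
  have "((\<lambda>\<epsilon>. damped_integrand \<tau> \<omega> \<epsilon> s) \<longlongrightarrow>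
      - 1 / (U \<tau> s * V \<tau> s) * cos (s * \<omega>) - - 1 / (exp (\<theta> \<tau>) * s * (s / exp (\<theta> \<tau>)))) (at_right 0)"
    unfolding damped_integrand_def using False U_V_nonzero
    by (intro tendsto_diff tendsto_mult_right damped_kernel_tendsto) auto
  also have "- 1 / (U \<tau> s * V \<tau> s) * cos (s * \<omega>) - - 1 / (exp (\<theta> \<tau>) * s * (s / exp (\<theta> \<tau>)))
      = limit_integrand \<tau> \<omega> s"
    by (simp add: limit_integrand_def power2_eq_square)
  finally show ?thesis .
qed

lemma integrable_limit_integrand: "integrable lborel (limit_integrand \<tau> \<omega>)"
  and integral_damped_integrand_tendsto:
    "((\<lambda>\<epsilon>. LINT s|lborel. damped_integrand \<tau> \<omega> \<epsilon> s) \<longlongrightarrow> (LINT s|lborel. limit_integrand \<tau> \<omega> s)) (at_right 0)"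
proof -
  obtain B where B: "\<And>\<epsilon> s. \<epsilon> > 0 \<Longrightarrow> \<bar>damped_integrand \<tau> \<omega> \<epsilon> s\<bar> \<le> B * (1 / (1 + s\<^sup>2))"
    using damped_integrand_bound by blast
  have meas: "limit_integrand \<tau> \<omega> \<in> borel_measurable lborel"
    "(\<lambda>s. damped_integrand \<tau> \<omega> (inverse x) s) \<in> borel_measurable lborel" for x
    unfolding limit_integrand_def [abs_def] damped_integrand_def damped_kernel_def by measurable
  have int: "integrable lborel (\<lambda>s::real. B * (1 / (1 + s\<^sup>2)))"
    by (intro integrable_mult_right integrable_1_over_1_plus_square)
  have lim: "AE s in lborel. ((\<lambda>x. damped_integrand \<tau> \<omega> (inverse x) s) \<longlongrightarrow> limit_integrand \<tau> \<omega> s) at_top"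
    using damped_integrand_tendsto by (simp add: filterlim_at_right_to_top)
  have bound: "\<forall>\<^sub>F x in at_top. AE s in lborel. norm (damped_integrand \<tau> \<omega> (inverse x) s) \<le> B * (1 / (1 + s\<^sup>2))"
    using eventually_gt_at_top[of 0] by eventually_elim (use B in auto)
  show "integrable lborel (limit_integrand \<tau> \<omega>)"
    using integrable_dominated_convergence_at_top[OF meas int lim bound] .
  show "((\<lambda>\<epsilon>. LINT s|lborel. damped_integrand \<tau> \<omega> \<epsilon> s) \<longlongrightarrow> (LINT s|lborel. limit_integrand \<tau> \<omega> s)) (at_right 0)"
    unfolding filterlim_at_right_to_top
    using integral_dominated_convergence_at_top[OF meas int lim bound] .
qed

lemma integral_damped_kernel_cos:
  assumes "\<epsilon> > 0"
  shows "integrable lborel (\<lambda>s. damped_kernel \<epsilon> (U \<tau> s) (V \<tau> s))"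
    and "(LINT s|lborel. damped_kernel \<epsilon> (U \<tau> s) (V \<tau> s) * cos (s * \<omega>)) =
         (LINT s|lborel. damped_integrand \<tau> \<omega> \<epsilon> s)"
proof -
  show int: "integrable lborel (\<lambda>s. damped_kernel \<epsilon> (U \<tau> s) (V \<tau> s))"
    by (rule integrable_damped_kernel[OF assms U_V_measurable interval_ge])
  have "integrable lborel (\<lambda>s. damped_kernel \<epsilon> (U \<tau> s) (V \<tau> s) * cos (s * \<omega>))"
    using int by (rule Bochner_Integration.integrable_bound)
      (auto intro!: borel_measurable_times damped_kernel_measurable simp: abs_mult mult_left_le)
  then show "(LINT s|lborel. damped_kernel \<epsilon> (U \<tau> s) (V \<tau> s) * cos (s * \<omega>)) =
      (LINT s|lborel. damped_integrand \<tau> \<omega> \<epsilon> s)"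
    using integral_damped_kernel_linear[OF assms, of "exp (\<theta> \<tau>)"]
    by (simp add: damped_integrand_def has_bochner_integral_iff)
qed

lemma autocorrelation_eq:
  assumes "norm e = 1" "s \<noteq> 0"
  shows "autocorrelation c (lorentz_psd f) t (straight_line x0 e z) \<tau> s =
           of_real (- f / (4 * pi\<^sup>2) / (U \<tau> s * V \<tau> s))"
proof -
  have "((\<lambda>\<epsilon>. of_real (f / (4 * pi\<^sup>2) * damped_kernel \<epsilon> (U \<tau> s) (V \<tau> s)) :: complex) \<longlongrightarrow>
      of_real (f / (4 * pi\<^sup>2) * (- 1 / (U \<tau> s * V \<tau> s)))) (at_right 0)"
    by (intro tendsto_of_real tendsto_mult_left damped_kernel_tendsto U_V_nonzero assms(2))
  moreover have "\<forall>\<^sub>F \<epsilon> in at_right 0. of_real (f / (4 * pi\<^sup>2) * damped_kernel \<epsilon> (U \<tau> s) (V \<tau> s)) =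
      signal_covariance c (damped (lorentz_psd f) \<epsilon>) t (straight_line x0 e z) \<tau> s"
    using eventually_at_right_less[of 0]
    by eventually_elim
       (simp only: signal_covariance_damped_lorentz[OF _ assms(1)] u_def [abs_def] v_def [abs_def])
  ultimately have "((\<lambda>\<epsilon>. signal_covariance c (damped (lorentz_psd f) \<epsilon>) t (straight_line x0 e z) \<tau> s) \<longlongrightarrow>
      of_real (f / (4 * pi\<^sup>2) * (- 1 / (U \<tau> s * V \<tau> s)))) (at_right 0)"
    by (rule Lim_transform_eventually)
  then show ?thesis
    unfolding autocorrelation_def by (subst tendsto_Lim) simp_all
qed

lemma wigner_eq:
  assumes "norm e = 1"
  shows "wigner c (lorentz_psd f) t (straight_line x0 e z) \<tau> \<omega> =
           of_real (f / (4 * pi\<^sup>2) * (LINT s|lborel. limit_integrand \<tau> \<omega> s))"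
proof -
  have "((\<lambda>\<epsilon>. of_real (f / (4 * pi\<^sup>2) * (LINT s|lborel. damped_integrand \<tau> \<omega> \<epsilon> s)) :: complex) \<longlongrightarrow>
      of_real (f / (4 * pi\<^sup>2) * (LINT s|lborel. limit_integrand \<tau> \<omega> s))) (at_right 0)"
    by (intro tendsto_of_real tendsto_mult_left integral_damped_integrand_tendsto)
  moreover have "\<forall>\<^sub>F \<epsilon> in at_right 0.
      of_real (f / (4 * pi\<^sup>2) * (LINT s|lborel. damped_integrand \<tau> \<omega> \<epsilon> s)) =
      (LINT s|lborel. signal_covariance c (damped (lorentz_psd f) \<epsilon>) t (straight_line x0 e z) \<tau> s * cis (\<omega> * s))"
    using eventually_at_right_less[of 0]
  proof eventually_elim
    case (elim \<epsilon>)
    let ?K = "\<lambda>s. damped_kernel \<epsilon> (U \<tau> s) (V \<tau> s)"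
    have "(LINT s|lborel. signal_covariance c (damped (lorentz_psd f) \<epsilon>) t (straight_line x0 e z) \<tau> s * cis (\<omega> * s)) =
        (LINT s|lborel. of_real (f / (4 * pi\<^sup>2)) * (of_real (?K s) * cis (s * \<omega>)))"
      by (simp only: signal_covariance_damped_lorentz[OF elim assms] u_def [abs_def] v_def [abs_def]
          of_real_mult mult.assoc mult.commute[of \<omega>])
    also have "\<dots> = of_real (f / (4 * pi\<^sup>2)) * (LINT s|lborel. of_real (?K s) * cis (s * \<omega>))"
      by simp
    also have "(LINT s|lborel. of_real (?K s) * cis (s * \<omega>)) = of_real (LINT s|lborel. ?K s * cos (s * \<omega>))"
      by (rule integral_even_cis[OF integral_damped_kernel_cos(1)[OF elim]])
         (simp add: central_diff_minus damped_kernel_def)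
    finally show ?case
      by (simp add: integral_damped_kernel_cos(2)[OF elim])
  qed
  ultimately have "((\<lambda>\<epsilon>. LINT s|lborel. signal_covariance c (damped (lorentz_psd f) \<epsilon>) t
      (straight_line x0 e z) \<tau> s * cis (\<omega> * s)) \<longlongrightarrow>
      of_real (f / (4 * pi\<^sup>2) * (LINT s|lborel. limit_integrand \<tau> \<omega> s))) (at_right 0)"
    by (rule Lim_transform_eventually)
  then show ?thesis
    unfolding wigner_def by (rule tendsto_Lim[rotated]) simp
qed

text \<open>
  At frequency \<open>0\<close> the integrand is \<open>1 / s\<^sup>2 - 1 / (U V)\<close>.  Its cosine transform differs from
  the integral at frequency \<open>\<omega>\<close> by \<open>\<integral> (1 - cos (s \<omega>)) / s\<^sup>2 ds\<close>, which is the same for all worldlines.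
  Uniqueness holds almost everywhere first, and then for all \<open>s \<noteq> 0\<close> by continuity.
\<close>

lemma integral_limit_integrand_unique:
  assumes eq: "\<And>\<omega>. (LINT s|lborel. limit_integrand \<tau> \<omega> s) = (LINT s|lborel. limit_integrand \<tau>' \<omega> s)"
  shows "U \<tau> s * V \<tau> s = U \<tau>' s * V \<tau>' s"
proof (cases "s = 0")
  case False
  define E where "E \<sigma> = limit_integrand \<sigma> 0" for \<sigma>
  have E: "E \<sigma> s = 1 / s\<^sup>2 - 1 / (U \<sigma> s * V \<sigma> s)" for \<sigma> s
    by (simp add: E_def limit_integrand_def)
  have int: "integrable lborel (E \<sigma>)" for \<sigma>
    unfolding E_def by (rule integrable_limit_integrand)
  then have [measurable]: "E \<sigma> \<in> borel_measurable borel" for \<sigma>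
    by auto
  have nonneg: "E \<sigma> s \<ge> 0" for \<sigma> s
    unfolding E using interval_ge[of s \<sigma>] interval_pos[of s \<sigma>]
    by (cases "s = 0") (auto intro!: divide_left_mono)
  have even: "E \<sigma> (- s) = E \<sigma> s" for \<sigma> s
    by (simp add: E central_diff_minus)
  have int_cos: "integrable lborel (\<lambda>s. E \<sigma> s * cos (s * \<omega>))" for \<sigma> \<omega>
    using int[of \<sigma>] by (rule Bochner_Integration.integrable_bound) (auto simp: abs_mult mult_left_le)
  have "(LINT s|lborel. E \<sigma> s * cos (s * \<omega>)) =
      (LINT s|lborel. limit_integrand \<sigma> \<omega> s) - (LINT s|lborel. (1 - cos (s * \<omega>)) / s\<^sup>2)" for \<sigma> \<omega>
  proof -
    have "(1 - cos (s * \<omega>)) / s\<^sup>2 = limit_integrand \<sigma> \<omega> s - E \<sigma> s * cos (s * \<omega>)" for s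
      by (simp add: E limit_integrand_def left_diff_distrib diff_divide_distrib)
    then show ?thesis
      using int_cos[of \<sigma> \<omega>] integrable_limit_integrand[of \<sigma> \<omega>] by simp
  qed
  then have "(LINT s|lborel. E \<tau> s * cos (s * \<omega>)) = (LINT s|lborel. E \<tau>' s * cos (s * \<omega>))" for \<omega>
    by (simp add: eq)
  then have ae: "AE s in lborel. E \<tau> s = E \<tau>' s"
    by (intro cosine_transform_unique int nonneg even)
  have cont: "continuous_on (- {0}) (E \<sigma>)" for \<sigma>
    unfolding E [abs_def] using U_V_nonzero
    by (intro continuous_intros U_V_continuous) auto
  have "E \<tau> s = E \<tau>' s"
    by (rule AE_lborel_eq_imp_eq_on_open[OF ae _ cont cont]) (use False in auto)
  then show ?thesis
    by (simp add: E)
qed simp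

end

theorem proposition4:
  fixes c f :: real and t z :: "real \<Rightarrow> real" and x0 e :: "real^3"
  assumes "c > 0" and "f > 0" and "norm e = 1"
    and "proper_time_motion c t z"
  shows "(stationary_signal c (lorentz_psd f) t (straight_line x0 e z) \<longleftrightarrow>
            rindler_motion c t z \<or> inertial_motion c t z) \<and>
         (stationary_wigner c (lorentz_psd f) t (straight_line x0 e z) \<longleftrightarrow>
            stationary_signal c (lorentz_psd f) t (straight_line x0 e z))"
proof -
  obtain \<theta> \<theta>1 \<theta>2 where "worldline c t z \<theta> \<theta>1 \<theta>2"
    using proper_time_motion_imp_worldline[OF assms(1,4)] .
  then interpret worldline c t z \<theta> \<theta>1 \<theta>2 .
  let ?x = "straight_line x0 e z"
  have signal: "stationary_signal c (lorentz_psd f) t ?x \<longleftrightarrow>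
      (\<forall>s \<tau> \<tau>'. U \<tau> s * V \<tau> s = U \<tau>' s * V \<tau>' s)"
  proof -
    have "autocorrelation c (lorentz_psd f) t ?x \<tau> s = autocorrelation c (lorentz_psd f) t ?x \<tau>' s \<longleftrightarrow>
        U \<tau> s * V \<tau> s = U \<tau>' s * V \<tau>' s" if "s \<noteq> 0" for s \<tau> \<tau>'
    proof -
      have "- f / (4 * pi\<^sup>2) \<noteq> 0"
        using assms(2) by simp
      moreover have "k / p = k / q \<longleftrightarrow> p = q" if "k \<noteq> 0" "p > 0" "q > 0" for k p q :: real
        using that by (auto simp: field_simps)
      ultimately show ?thesis
        unfolding autocorrelation_eq[OF assms(3) that] of_real_eq_iff
        using interval_pos[OF that] by blast
    qed
    then show ?thesis
      unfolding stationary_signal_def by (metis central_diff_0 mult_zero_left)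
  qed
  have wigner: "stationary_wigner c (lorentz_psd f) t ?x \<longleftrightarrow>
      (\<forall>\<omega> \<tau> \<tau>'. (LINT s|lborel. limit_integrand \<tau> \<omega> s) = (LINT s|lborel. limit_integrand \<tau>' \<omega> s))"
    unfolding stationary_wigner_def wigner_eq[OF assms(3)] using assms(2) by simp
  have "stationary_signal c (lorentz_psd f) t ?x \<longleftrightarrow> rindler_motion c t z \<or> inertial_motion c t z"
  proof
    assume "stationary_signal c (lorentz_psd f) t ?x"
    then obtain k m where "\<And>\<tau>. \<theta> \<tau> = k * \<tau> + m"
      using interval_invariant_imp_affine_rapidity signal by blast
    then show "rindler_motion c t z \<or> inertial_motion c t z"
      by (rule affine_rapidity_imp_rindler_or_inertial)
  next
    assume "rindler_motion c t z \<or> inertial_motion c t z"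
    from rindler_or_inertial_imp_interval_invariant[OF assms(1) this]
    show "stationary_signal c (lorentz_psd f) t ?x"
      unfolding signal u_def [abs_def] v_def [abs_def] by blast
  qed
  moreover have "stationary_wigner c (lorentz_psd f) t ?x \<longleftrightarrow> stationary_signal c (lorentz_psd f) t ?x"
  proof
    assume "stationary_wigner c (lorentz_psd f) t ?x"
    then show "stationary_signal c (lorentz_psd f) t ?x"
      unfolding signal wigner using integral_limit_integrand_unique by blast
  next
    assume "stationary_signal c (lorentz_psd f) t ?x"
    then have "limit_integrand \<tau> = limit_integrand \<tau>'" for \<tau> \<tau>'
      unfolding signal limit_integrand_def [abs_def] by metis
    then show "stationary_wigner c (lorentz_psd f) t ?x"
      unfolding wigner by metis
  qed
  ultimately show ?thesis by blast
qed

end
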